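(* Let $n\ge 3$, $\ell>0$, $r_0>0$, $a\in\mathbb{R}$, let $V(r)=\frac{r^2}{\ell^2}\left(1+\frac{a}{r^{n-1}}-\frac{r_0^n}{r^n}\right)$, let $r_+>0$ be its largest positive root, and let $$g=\frac1V dr^2+V d\phi^2+r^2\sum_{i=1}^{n-2}(d\theta^i)^2,$$ where each $\theta^i$ is periodic with an arbitrary period and $\phi$ is periodic with period $\beta=\frac{4\pi\ell^2}{r_+\left(n-1+r_0^n/r_+^n\right)}$. Let $N=N(r,\phi,\theta^i)$ be a positive smooth function, defined for $r>r_+$ (and periodic in $\phi$ with period $\beta$ and in each $\theta^i$ with the period of the coordinate $\theta^i$). Suppose that the $(n+1)$-dimensional Lorentzian metric $$\widetilde g=-N^2dt^2+\frac{1}{V}dr^2+V d\phi^2+r^2\sum_{i=1}^{n-2}(d\theta^i)^2$$ satisfies the vacuum Einstein field equations $$\operatorname{Ric}_{\widetilde g}-\frac12\operatorname{Scal}_{\widetilde g}\,\widetilde g+\Lambda\,\widetilde g=0$$ for a negative cosmological constant $\Lambda<0$. Then $$N=c\,r,\qquad \ell^2=-\frac{n(n-1)}{2\Lambda},\qquad V=\frac{r^2}{\ell^2}\left(1-\frac{r_0^n}{r^n}\right),$$ where $c$ is some positive constant, which can be chosen to be $1$ by defining a new time $\tilde t=ct$. Therefore $\widetilde g$ is an AdS soliton.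
   Context: $V>0$ on $(r_+,\infty)$ and $V(r_+)=0$. $\operatorname{Ric}$ and $\operatorname{Scal}$ denote Ricci and scalar curvature. An AdS soliton (Horowitz--Myers) is a spacetime metric of the form $$-r^{2}dt^{2}+\frac{1}{\frac{r^{2}}{\ell^{2}}\left(1-\frac{r_{0}^{n}}{r^{n}}\right)}dr^{2}+\frac{r^{2}}{\ell^{2}}\left(1-\frac{r_{0}^{n}}{r^{n}}\right)d\phi^{2}+r^{2}\sum_{i=1}^{n-2}(d\theta^{i})^{2}$$ with $r_0>0$. *)

theory Defs
  imports "HOL-Analysis.Analysis"
begin

section \<open>Coordinate calculus of metrics\<close>

text \<open>A metric on a coordinate chart is a matrix-valued function of the coordinates
  \<open>x :: real^'m\<close>. All notions below are local, so the values of a metric outside the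
  open chart domain under consideration play no role.\<close>

definition partial_deriv :: "'m::finite \<Rightarrow> (real^'m \<Rightarrow> real) \<Rightarrow> real^'m \<Rightarrow> real" where
  "partial_deriv i f x = deriv (\<lambda>s. f (x + s *\<^sub>R axis i 1)) 0"

text \<open>On an open set, \<open>C\<^sup>\<infinity>\<close> is the same as (Frechet) differentiability of
  the iterated partial derivatives of every order, including order zero.\<close>

definition smooth_on :: "(real^'m::finite) set \<Rightarrow> (real^'m \<Rightarrow> real) \<Rightarrow> bool" where
  "smooth_on U f \<longleftrightarrow> (\<forall>is :: 'm list. (foldr partial_deriv is f) differentiable_on U)"

definition christoffel ::
    "(real^'m \<Rightarrow> real^'m^'m) \<Rightarrow> 'm::finite \<Rightarrow> 'm \<Rightarrow> 'm \<Rightarrow> real^'m \<Rightarrow> real" where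
  "christoffel g k i j x = (1/2) * (\<Sum>l\<in>UNIV. matrix_inv (g x) $ k $ l *
     (partial_deriv i (\<lambda>y. g y $ j $ l) x + partial_deriv j (\<lambda>y. g y $ i $ l) x
        - partial_deriv l (\<lambda>y. g y $ i $ j) x))"

text \<open>\<open>riemann g k l i j\<close> is the component \<open>R\<^sup>k\<^sub>l\<^sub>i\<^sub>j\<close> of
  \<open>R(\<partial>\<^sub>i, \<partial>\<^sub>j)\<partial>\<^sub>l\<close>; with the contraction in \<open>ricci\<close>, round spheres have positive
  Ricci curvature.\<close>

definition riemann ::
    "(real^'m \<Rightarrow> real^'m^'m) \<Rightarrow> 'm::finite \<Rightarrow> 'm \<Rightarrow> 'm \<Rightarrow> 'm \<Rightarrow> real^'m \<Rightarrow> real" where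
  "riemann g k l i j x =
     partial_deriv i (christoffel g k j l) x - partial_deriv j (christoffel g k i l) x
     + (\<Sum>m\<in>UNIV. christoffel g k i m x * christoffel g m j l x
                 - christoffel g k j m x * christoffel g m i l x)"

definition ricci :: "(real^'m \<Rightarrow> real^'m^'m) \<Rightarrow> real^'m::finite \<Rightarrow> real^'m^'m" where
  "ricci g x = (\<chi> l j. \<Sum>k\<in>UNIV. riemann g k l k j x)"

definition scalar_curvature :: "(real^'m \<Rightarrow> real^'m^'m) \<Rightarrow> real^'m::finite \<Rightarrow> real" where
  "scalar_curvature g x = (\<Sum>i\<in>UNIV. \<Sum>j\<in>UNIV. matrix_inv (g x) $ i $ j * ricci g x $ i $ j)"

definition vacuum_einstein_on ::
    "(real^'m::finite) set \<Rightarrow> real \<Rightarrow> (real^'m \<Rightarrow> real^'m^'m) \<Rightarrow> bool" where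
  "vacuum_einstein_on U \<Lambda> g \<longleftrightarrow>
     (\<forall>x\<in>U. ricci g x - ((1/2) * scalar_curvature g x) *\<^sub>R g x + \<Lambda> *\<^sub>R g x = 0)"

definition pullback_metric ::
    "(real^'m \<Rightarrow> real^'m) \<Rightarrow> (real^'m \<Rightarrow> real^'m^'m) \<Rightarrow> real^'m::finite \<Rightarrow> real^'m^'m" where
  "pullback_metric F g x =
     transpose (jacobian F (at x)) ** g (F x) ** jacobian F (at x)"


section \<open>Coordinates and metrics of soliton type\<close>

text \<open>Spatial coordinates: \<open>Rad\<close> is \<open>r\<close>, \<open>Ang\<close> is \<open>\<phi>\<close>, and \<open>Tor i\<close> is
  \<open>\<theta>\<^sup>i\<close>. The index type \<open>'k\<close> of the \<open>\<theta>\<^sup>i\<close> has \<open>n - 2\<close> elements, so the spatial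
  dimension is \<open>n = CARD('k) + 2\<close>. Spacetime coordinates are indexed by
  \<open>'k space_coord option\<close>, where \<open>None\<close> is the time \<open>t\<close>.\<close>

datatype 'k space_coord = Rad | Ang | Tor 'k

instance space_coord :: (finite) finite
proof
  have "UNIV = insert Rad (insert Ang (range (Tor :: 'a \<Rightarrow> 'a space_coord)))"
    by (auto intro: space_coord.exhaust)
  then show "finite (UNIV :: 'a space_coord set)"
    by (metis finite finite_imageI finite_insert)
qed

definition space_part :: "real^('s option) \<Rightarrow> real^('s::finite)" where
  "space_part x = (\<chi> i. x $ Some i)"

definition spatial_metric ::
    "(real \<Rightarrow> real) \<Rightarrow> real^('k space_coord) \<Rightarrow> real^('k space_coord)^('k::finite space_coord)" where
  "spatial_metric V x = (\<chi> i j. if i \<noteq> j then 0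
     else (case i of Rad \<Rightarrow> 1 / V (x $ Rad) | Ang \<Rightarrow> V (x $ Rad) | Tor _ \<Rightarrow> (x $ Rad)\<^sup>2))"

definition static_metric ::
    "(real^'s \<Rightarrow> real) \<Rightarrow> (real^'s \<Rightarrow> real^'s^'s) \<Rightarrow>
     real^('s option) \<Rightarrow> real^('s option)^('s::finite option)" where
  "static_metric N g x = (\<chi> i j. case (i, j) of
       (None, None) \<Rightarrow> - (N (space_part x))\<^sup>2
     | (Some p, Some q) \<Rightarrow> g (space_part x) $ p $ q
     | _ \<Rightarrow> 0)"

definition time_scale :: "real \<Rightarrow> real^('s option) \<Rightarrow> real^('s::finite option)" where
  "time_scale s x = (\<chi> i. case i of None \<Rightarrow> s * x $ None | Some p \<Rightarrow> x $ Some p)"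

text \<open>The Horowitz--Myers metric, where \<open>L\<close> is the AdS radius and
  \<open>CARD('k) + 2\<close> is the spatial dimension.\<close>

definition AdS_soliton_on ::
    "real \<Rightarrow> real \<Rightarrow> (real^('k space_coord option)) set \<Rightarrow>
     (real^('k space_coord option) \<Rightarrow>
        real^('k space_coord option)^('k::finite space_coord option)) \<Rightarrow> bool" where
  "AdS_soliton_on L r0 U h \<longleftrightarrow> L > 0 \<and> r0 > 0 \<and> U = {x. x $ Some Rad > r0} \<and>
     (\<forall>x\<in>U. h x = static_metric (\<lambda>y. y $ Rad)
        (spatial_metric (\<lambda>r. r\<^sup>2 / L\<^sup>2 * (1 - r0 ^ (CARD('k) + 2) / r ^ (CARD('k) + 2)))) x)"

end

theory Submission
  imports Defs
begin

text \<open>For a static metric the vacuum equations split over the spatial metric \<open>g\<close>: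
  \<open>\<Delta>N = - \<mu> N\<close> and \<open>N Ric\<^sub>g - Hess N = \<mu> N g\<close>, where \<open>\<mu> = 2\<Lambda>/(n - 1)\<close>
  (lemmas \<open>ricci_static\<close> and \<open>vacuum_einstein_imp_ricci\<close>). The trace of the second
  equation, combined with the first, shows that \<open>g\<close> has constant scalar curvature
  \<open>2\<Lambda>\<close>. For every member of the given family of profiles the scalar curvature is
  \<open>- n(n - 1)/L\<^sup>2\<close>, because the powers \<open>r\<^sup>3\<^sup>-\<^sup>n\<close> and \<open>r\<^sup>2\<^sup>-\<^sup>n\<close> in \<open>V\<close> are annihilated by the
  scalar curvature operator; hence the value of \<open>L\<close>.

  It remains to show \<open>a = 0\<close> and \<open>N = c r\<close>; only individual components of the second
  equation are used. The components \<open>(r, \<phi>)\<close> and \<open>(\<theta>, \<phi>)\<close> say that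
  \<open>\<partial>\<^sub>r N - V'/(2V) N\<close> and \<open>\<partial>\<^sub>\<theta> N\<close> do not depend on \<open>\<phi>\<close>. Comparing the
  \<open>(\<theta>, \<theta>)\<close> component at two values of \<open>\<phi>\<close> then shows that the difference of the two values
  of \<open>N\<close>, times a function of \<open>r\<close> with at most one zero, vanishes (\<open>angular_shift\<close>).
  So \<open>N\<close> is independent of \<open>\<phi>\<close>.

  The \<open>(\<phi>, \<phi>)\<close> component now prescribes \<open>\<partial>\<^sub>r N / N\<close> as a function of \<open>r\<close>, and
  with it the \<open>(\<theta>, \<theta>)\<close> component prescribes \<open>\<partial>\<^sub>\<theta>\<partial>\<^sub>\<theta> N / N\<close> as a function of \<open>r\<close>.
  But \<open>N\<close> is periodic in \<open>\<theta>\<close>, so its second derivative vanishes somewhere on each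
  \<open>\<theta>\<close>-circle, and the latter function is zero. Written out, this is \<open>a\<close> times a positive quantity
  being zero (\<open>a_zero\<close>). With \<open>a = 0\<close> the two equations become
  \<open>r \<partial>\<^sub>r N = N\<close> and \<open>\<partial>\<^sub>\<theta>\<partial>\<^sub>\<theta> N = 0\<close>; periodicity turns the second
  into \<open>\<partial>\<^sub>\<theta> N = 0\<close>, and \<open>N/r\<close> is constant (\<open>lapse_linear\<close>).\<close>

section \<open>Coordinate partial derivatives\<close>

lemma partial_deriv_cong_open:
  assumes "open U" "x \<in> U" "\<And>y. y \<in> U \<Longrightarrow> f y = g y"
  shows "partial_deriv i f x = partial_deriv i g x"
proof -
  have "((\<lambda>s. x + s *\<^sub>R axis i 1) \<longlongrightarrow> x + 0 *\<^sub>R axis i 1) (nhds 0)"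
    by (intro tendsto_intros filterlim_ident)
  then have "((\<lambda>s. x + s *\<^sub>R axis i 1) \<longlongrightarrow> x) (nhds 0)" by simp
  then have "\<forall>\<^sub>F s in nhds 0. x + s *\<^sub>R axis i 1 \<in> U"
    using assms(1,2) by (rule topological_tendstoD)
  then have "\<forall>\<^sub>F s in nhds 0. f (x + s *\<^sub>R axis i 1) = g (x + s *\<^sub>R axis i 1)"
    by (rule eventually_mono) (use assms(3) in auto)
  then show ?thesis
    unfolding partial_deriv_def by (intro deriv_cong_ev) auto
qed

lemma has_derivative_along_line:
  fixes f :: "real^'m::finite \<Rightarrow> real"
  assumes "f differentiable (at x)"
  shows "((\<lambda>s. f (x + s *\<^sub>R axis i 1)) has_real_derivative frechet_derivative f (at x) (axis i 1)) (at 0)"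
proof -
  let ?F = "frechet_derivative f (at x)"
  have "(f has_derivative ?F) (at (x + 0 *\<^sub>R axis i 1))"
    using assms by (simp add: frechet_derivative_works)
  moreover have "((\<lambda>s. x + s *\<^sub>R axis i 1) has_derivative (\<lambda>s. s *\<^sub>R axis i 1)) (at 0)"
    by (auto intro!: derivative_eq_intros)
  ultimately have "((\<lambda>s. f (x + s *\<^sub>R axis i 1)) has_derivative (\<lambda>s. ?F (s *\<^sub>R axis i 1))) (at 0)"
    by (rule has_derivative_compose[rotated])
  then show ?thesis
    unfolding has_field_derivative_def
    by (simp add: linear_scale[OF linear_frechet_derivative[OF assms]] mult_commute_abs)
qed

lemma partial_deriv_eqI:
  "((\<lambda>s. f (x + s *\<^sub>R axis i 1)) has_real_derivative D) (at 0) \<Longrightarrow> partial_deriv i f x = D"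
  unfolding partial_deriv_def by (rule DERIV_imp_deriv)

lemma differentiable_has_partial_deriv:
  fixes f :: "real^'m::finite \<Rightarrow> real"
  assumes "f differentiable (at x)"
  shows "((\<lambda>s. f (x + s *\<^sub>R axis i 1)) has_real_derivative partial_deriv i f x) (at 0)"
  using has_derivative_along_line[OF assms, of i] partial_deriv_eqI by metis

lemma partial_deriv_const [simp]: "partial_deriv i (\<lambda>y. c) x = 0"
  by (rule partial_deriv_eqI) simp

lemma frechet_derivative_eq_partial_derivs:
  fixes f :: "real^'m::finite \<Rightarrow> real"
  assumes "f differentiable (at x)"
  shows "frechet_derivative f (at x) v = (\<Sum>i\<in>UNIV. v $ i * partial_deriv i f x)"
proof -
  let ?F = "frechet_derivative f (at x)"
  have lin: "linear ?F" using assms by (rule linear_frechet_derivative)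
  have "v = (\<Sum>i\<in>UNIV. v $ i *\<^sub>R axis i 1)"
    using basis_expansion[of v] by (simp add: scalar_mult_eq_scaleR)
  then have "?F v = (\<Sum>i\<in>UNIV. v $ i *\<^sub>R ?F (axis i 1))"
    by (metis (no_types, lifting) linear_sum[OF lin] linear_scale[OF lin] sum.cong)
  then show ?thesis
    by (simp add: partial_deriv_eqI[OF has_derivative_along_line[OF assms]])
qed

lemma partial_deriv_mult:
  assumes "f differentiable (at x)" "h differentiable (at x)"
  shows "partial_deriv i (\<lambda>y. f y * h y) x = partial_deriv i f x * h x + f x * partial_deriv i h x"
  by (rule partial_deriv_eqI)
    (auto intro!: derivative_eq_intros differentiable_has_partial_deriv assms)

lemma partial_deriv_divide:
  assumes "f differentiable (at x)" "h differentiable (at x)" "h x \<noteq> 0"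
  shows "partial_deriv i (\<lambda>y. f y / h y) x =
    partial_deriv i f x / h x - f x * partial_deriv i h x / (h x)\<^sup>2"
  by (rule partial_deriv_eqI)
    (use assms in \<open>auto intro!: derivative_eq_intros differentiable_has_partial_deriv
      simp: field_simps power2_eq_square\<close>)

lemma partial_deriv_diff:
  assumes "f differentiable (at x)" "h differentiable (at x)"
  shows "partial_deriv i (\<lambda>y. f y - h y) x = partial_deriv i f x - partial_deriv i h x"
  by (rule partial_deriv_eqI)
    (auto intro!: derivative_eq_intros differentiable_has_partial_deriv assms)

lemma partial_deriv_coordinate:
  assumes "(F has_real_derivative D) (at (x $ j))"
  shows "partial_deriv i (\<lambda>y. F (y $ j)) x = (if i = j then D else 0)"
proof (rule partial_deriv_eqI)
  have "((\<lambda>s. x $ j + s) has_real_derivative 1) (at 0)"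
    by (auto intro!: derivative_eq_intros)
  then have "((\<lambda>s. F (x $ j + s)) has_real_derivative D) (at 0)"
    using DERIV_chain2[of F D "\<lambda>s. x $ j + s" 0 1 UNIV] assms by simp
  then show "((\<lambda>s. F ((x + s *\<^sub>R axis i 1) $ j)) has_real_derivative (if i = j then D else 0)) (at 0)"
    by (auto simp: axis_def)
qed

lemma differentiable_coordinate:
  assumes "(F has_real_derivative D) (at (x $ j))"
  shows "(\<lambda>y. F (y $ j)) differentiable (at x)"
proof -
  have "((\<lambda>y. y $ j) has_derivative (\<lambda>y. y $ j)) (at x)"
    by (rule bounded_linear_imp_has_derivative) (rule bounded_linear_vec_nth)
  from has_derivative_compose[OF this assms[unfolded has_field_derivative_def]]
  show ?thesis by (auto simp: differentiable_def)
qed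

lemma partial_deriv_along_line:
  fixes f :: "real^'m::finite \<Rightarrow> real"
  assumes "f differentiable (at (x + s *\<^sub>R axis i 1))"
  shows "((\<lambda>s. f (x + s *\<^sub>R axis i 1)) has_real_derivative
     partial_deriv i f (x + s *\<^sub>R axis i 1)) (at s)"
proof -
  have "((\<lambda>t. f (x + s *\<^sub>R axis i 1 + t *\<^sub>R axis i 1)) has_real_derivative
     partial_deriv i f (x + s *\<^sub>R axis i 1)) (at 0)"
    by (rule differentiable_has_partial_deriv[OF assms])
  then have "((\<lambda>t. f (x + (t + s) *\<^sub>R axis i 1)) has_real_derivative
     partial_deriv i f (x + s *\<^sub>R axis i 1)) (at 0)"
    by (simp add: algebra_simps)
  then show ?thesis
    using DERIV_shift[of "\<lambda>s. f (x + s *\<^sub>R axis i 1)" _ 0 s] by simp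
qed

lemma constant_along_line:
  fixes f :: "real^'m::finite \<Rightarrow> real"
  assumes "\<And>s. f differentiable (at (x + s *\<^sub>R axis i 1))"
    and "\<And>s. partial_deriv i f (x + s *\<^sub>R axis i 1) = 0"
  shows "f (x + s *\<^sub>R axis i 1) = f x"
proof -
  have "((\<lambda>s. f (x + s *\<^sub>R axis i 1)) has_real_derivative 0) (at s)" for s
    using partial_deriv_along_line[of f x s i] assms by simp
  then show ?thesis
    using DERIV_isconst_all[of "\<lambda>s. f (x + s *\<^sub>R axis i 1)" s 0] by simp
qed

lemma smooth_on_imp:
  assumes "smooth_on U f" "open U" "x \<in> U"
  shows "f differentiable (at x)" "partial_deriv i f differentiable (at x)"
proof -
  have *: "foldr partial_deriv is f differentiable (at x)" for "is"
    using assms unfolding smooth_on_def differentiable_on_def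
    by (metis at_within_open)
  show "f differentiable (at x)" "partial_deriv i f differentiable (at x)"
    using *[of "[]"] *[of "[i]"] by simp_all
qed

section \<open>Inverse matrices\<close>

lemma matrix_inv_eqI:
  fixes A B :: "real^'m::finite^'m"
  assumes "A ** B = mat 1"
  shows "matrix_inv A = B"
proof -
  have BA: "B ** A = mat 1" using assms by (simp add: matrix_left_right_inverse)
  have "\<exists>A'. A ** A' = mat 1 \<and> A' ** A = mat 1" using assms BA by blast
  then have "A ** matrix_inv A = mat 1 \<and> matrix_inv A ** A = mat 1"
    unfolding matrix_inv_def by (rule someI_ex)
  then show ?thesis using BA
    by (metis matrix_mul_assoc matrix_mul_lid matrix_mul_rid)
qed

lemma invertible_matrix_inv:
  fixes A :: "real^'m::finite^'m"
  assumes "invertible A"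
  shows "A ** matrix_inv A = mat 1" "matrix_inv A ** A = mat 1"
  using assms matrix_inv_eqI unfolding invertible_def by blast+

lemma diagonal_matrix_mult:
  fixes d e :: "'m::finite \<Rightarrow> real"
  assumes "\<And>i. d i * e i = 1"
  shows "(\<chi> i j. if i = j then d i else 0) ** (\<chi> i j. if i = j then e i else 0) = mat 1"
proof -
  have "(\<Sum>k\<in>UNIV. (if i = k then d i else 0) * (if k = j then e k else 0)) =
      (\<Sum>k\<in>UNIV. if k = i then (if i = j then 1 else 0) else 0)" for i j
    by (rule sum.cong) (auto simp: assms)
  then show ?thesis by (simp add: matrix_matrix_mult_def vec_eq_iff mat_def)
qed

section \<open>Static metrics\<close>

lemma sum_UNIV_option:
  "(\<Sum>i\<in>UNIV. f i) = f None + (\<Sum>p\<in>UNIV. f (Some p))" for f :: "'s::finite option \<Rightarrow> real"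
  by (simp add: UNIV_option_conv sum.reindex)

lemma static_metric_nth [simp]:
  "static_metric N g x $ None $ None = - (N (space_part x))\<^sup>2"
  "static_metric N g x $ None $ Some q = 0"
  "static_metric N g x $ Some p $ None = 0"
  "static_metric N g x $ Some p $ Some q = g (space_part x) $ p $ q"
  by (simp_all add: static_metric_def)

lemma space_part_shift [simp]:
  "space_part (x + s *\<^sub>R axis (Some p) 1) = space_part x + s *\<^sub>R axis p 1"
  "space_part (x + s *\<^sub>R axis None 1) = space_part x"
  by (simp_all add: space_part_def vec_eq_iff axis_def)

lemma partial_deriv_space_part [simp]:
  "partial_deriv (Some p) (\<lambda>y. f (space_part y)) x = partial_deriv p f (space_part x)"
  "partial_deriv None (\<lambda>y. f (space_part y)) x = 0"
  by (simp_all add: partial_deriv_def)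

lemma open_space_part:
  fixes S :: "(real^'s::finite) set"
  assumes "open S"
  shows "open {x. space_part x \<in> S}"
proof -
  have "continuous_on UNIV (space_part :: real^('s option) \<Rightarrow> real^'s)"
    unfolding space_part_def by (intro continuous_intros)
  then show ?thesis
    using assms open_vimage[of S space_part] by (simp add: vimage_def)
qed

lemma static_metric_inverse:
  assumes inv: "invertible (g (space_part x))" and N: "N (space_part x) \<noteq> 0"
  shows "static_metric N g x ** (\<chi> i j. case (i, j) of (None, None) \<Rightarrow> - 1 / (N (space_part x))\<^sup>2
     | (Some p, Some q) \<Rightarrow> matrix_inv (g (space_part x)) $ p $ q | _ \<Rightarrow> 0) = mat 1" (is "_ ** ?B = _")
proof -
  have "g (space_part x) ** matrix_inv (g (space_part x)) = mat 1"
    by (rule invertible_matrix_inv[OF inv])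
  then have *: "(\<Sum>r\<in>UNIV. g (space_part x) $ p $ r * matrix_inv (g (space_part x)) $ r $ q) =
      (if p = q then 1 else 0)" for p q
    by (simp add: matrix_matrix_mult_def vec_eq_iff mat_def)
  show ?thesis
    unfolding vec_eq_iff
  proof (intro allI)
    fix i j
    show "(static_metric N g x ** ?B) $ i $ j = mat 1 $ i $ j"
      using N by (cases i; cases j) (simp_all add: matrix_matrix_mult_def sum_UNIV_option mat_def *)
  qed
qed

lemma invertible_static_metric:
  assumes "invertible (g (space_part x))" "N (space_part x) \<noteq> 0"
  shows "invertible (static_metric N g x)"
  using static_metric_inverse[where g = g and N = N and x = x, OF assms] invertible_right_inverse by blast

lemma matrix_inv_static_metric [simp]:
  assumes "invertible (g (space_part x))" "N (space_part x) \<noteq> 0"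
  shows "matrix_inv (static_metric N g x) $ None $ None = - 1 / (N (space_part x))\<^sup>2"
    "matrix_inv (static_metric N g x) $ None $ Some q = 0"
    "matrix_inv (static_metric N g x) $ Some p $ None = 0"
    "matrix_inv (static_metric N g x) $ Some p $ Some q = matrix_inv (g (space_part x)) $ p $ q"
  by (simp_all add: matrix_inv_eqI[OF static_metric_inverse[where g = g and N = N and x = x, OF assms]])

text \<open>The gradient carries an upper index, so that \<open>laplacian\<close> below is its covariant divergence.\<close>

definition gradient where
  "gradient g N p x = (\<Sum>q\<in>UNIV. matrix_inv (g x) $ p $ q * partial_deriv q N x)"

definition hessian where
  "hessian g N l j x = partial_deriv j (partial_deriv l N) x
     - (\<Sum>m\<in>UNIV. christoffel g m j l x * partial_deriv m N x)"

definition laplacian where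
  "laplacian g N x = (\<Sum>p\<in>UNIV. partial_deriv p (gradient g N p) x
     + (\<Sum>q\<in>UNIV. christoffel g p p q x * gradient g N q x))"

lemma partial_deriv_neg_square:
  assumes "N differentiable (at x)"
  shows "partial_deriv p (\<lambda>y. - (N y)\<^sup>2) x = - (2 * N x * partial_deriv p N x)"
  by (rule partial_deriv_eqI)
    (auto intro!: derivative_eq_intros differentiable_has_partial_deriv assms)

lemma christoffel_static:
  fixes g :: "real^'s::finite \<Rightarrow> real^'s^'s"
  assumes inv: "invertible (g (space_part x))" and N: "N (space_part x) \<noteq> 0"
    and diff: "N differentiable (at (space_part x))"
  shows "christoffel (static_metric N g) None None None x = 0"
    "christoffel (static_metric N g) None None (Some p) x =
       partial_deriv p N (space_part x) / N (space_part x)"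
    "christoffel (static_metric N g) None (Some p) None x =
       partial_deriv p N (space_part x) / N (space_part x)"
    "christoffel (static_metric N g) None (Some p) (Some q) x = 0"
    "christoffel (static_metric N g) (Some s) None None x =
       N (space_part x) * gradient g N s (space_part x)"
    "christoffel (static_metric N g) (Some s) None (Some p) x = 0"
    "christoffel (static_metric N g) (Some s) (Some p) None x = 0"
    "christoffel (static_metric N g) (Some s) (Some p) (Some q) x =
       christoffel g s p q (space_part x)"
proof -
  have L: "partial_deriv (Some p) (\<lambda>y. - (N (space_part y))\<^sup>2) x =
      - (2 * N (space_part x) * partial_deriv p N (space_part x))" for p
    using partial_deriv_space_part(1)[of p "\<lambda>y. - (N y)\<^sup>2" x] partial_deriv_neg_square[OF diff]
    by simp
  have L0: "partial_deriv None (\<lambda>y. - (N (space_part y))\<^sup>2) x = 0"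
    by (rule partial_deriv_space_part(2))
  have L1: "partial_deriv (Some p) (\<lambda>y. g (space_part y) $ i $ j) x =
      partial_deriv p (\<lambda>y. g y $ i $ j) (space_part x)" for p i j
    by (rule partial_deriv_space_part(1))
  have L2: "partial_deriv None (\<lambda>y. g (space_part y) $ i $ j) x = 0" for i j
    by (rule partial_deriv_space_part(2)[of "\<lambda>y. g y $ i $ j"])
  note defs = christoffel_def sum_UNIV_option matrix_inv_static_metric[where g = g and N = N and x = x, OF inv N] L L0 L1 L2
  show "christoffel (static_metric N g) None None None x = 0"
    "christoffel (static_metric N g) None (Some p) (Some q) x = 0"
    "christoffel (static_metric N g) (Some s) None (Some p) x = 0"
    "christoffel (static_metric N g) (Some s) (Some p) None x = 0"
    "christoffel (static_metric N g) (Some s) (Some p) (Some q) x =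
       christoffel g s p q (space_part x)"
    by (simp_all add: defs)
  show "christoffel (static_metric N g) None None (Some p) x =
       partial_deriv p N (space_part x) / N (space_part x)"
    "christoffel (static_metric N g) None (Some p) None x =
       partial_deriv p N (space_part x) / N (space_part x)"
    using N by (simp_all add: defs) (simp_all add: power2_eq_square)
  show "christoffel (static_metric N g) (Some s) None None x =
       N (space_part x) * gradient g N s (space_part x)"
    by (simp add: defs gradient_def sum_distrib_left mult_ac)
qed

text \<open>In the spatial components the time index contributes \<open>\<Gamma>\<^sup>t\<^sub>t\<^sub>l = \<partial>\<^sub>l N / N\<close>, and
  \<open>- \<partial>\<^sub>j (\<partial>\<^sub>l N / N) - \<partial>\<^sub>l N \<partial>\<^sub>j N / N\<^sup>2\<close> collapses to \<open>- \<partial>\<^sub>j \<partial>\<^sub>l N / N\<close>; together with the remaining product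
  this is the Hessian. The purely spatial indices reproduce the curvature of \<open>g\<close>. In the time component,
  the vector \<open>\<Gamma>\<^sup>p\<^sub>t\<^sub>t\<close> is \<open>N\<close> times the gradient, and the terms quadratic in the gradient cancel.\<close>

lemma ricci_static:
  fixes g :: "real^'s::finite \<Rightarrow> real^'s^'s"
  assumes S: "open S" and xS: "space_part x \<in> S"
    and inv: "\<And>y. y \<in> S \<Longrightarrow> invertible (g y)" and N: "\<And>y. y \<in> S \<Longrightarrow> N y \<noteq> 0"
    and diff: "\<And>y. y \<in> S \<Longrightarrow> N differentiable (at y)"
    and diff2: "\<And>p y. y \<in> S \<Longrightarrow> partial_deriv p N differentiable (at y)"
    and diffW: "\<And>p y. y \<in> S \<Longrightarrow> gradient g N p differentiable (at y)"
  shows "ricci (static_metric N g) x $ Some l $ Some j =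
      ricci g (space_part x) $ l $ j - hessian g N l j (space_part x) / N (space_part x)"
    "ricci (static_metric N g) x $ None $ None =
      N (space_part x) * laplacian g N (space_part x)"
proof -
  define U where "U = {x::real^('s option). space_part x \<in> S}"
  have U: "open U" "x \<in> U" using open_space_part[OF S] xS by (auto simp: U_def)
  have chr: "y \<in> U \<Longrightarrow> christoffel (static_metric N g) None None None y = 0"
    "y \<in> U \<Longrightarrow> christoffel (static_metric N g) None None (Some p) y =
       partial_deriv p N (space_part y) / N (space_part y)"
    "y \<in> U \<Longrightarrow> christoffel (static_metric N g) None (Some p) None y =
       partial_deriv p N (space_part y) / N (space_part y)"
    "y \<in> U \<Longrightarrow> christoffel (static_metric N g) None (Some p) (Some q) y = 0"
    "y \<in> U \<Longrightarrow> christoffel (static_metric N g) (Some s) None None y =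
       N (space_part y) * gradient g N s (space_part y)"
    "y \<in> U \<Longrightarrow> christoffel (static_metric N g) (Some s) None (Some p) y = 0"
    "y \<in> U \<Longrightarrow> christoffel (static_metric N g) (Some s) (Some p) None y = 0"
    "y \<in> U \<Longrightarrow> christoffel (static_metric N g) (Some s) (Some p) (Some q) y =
       christoffel g s p q (space_part y)" for y p q s
    using christoffel_static[of g y N] inv N diff by (auto simp: U_def)
  have pd: "partial_deriv a (christoffel (static_metric N g) b c d) x = partial_deriv a F x"
    if "\<And>y. y \<in> U \<Longrightarrow> christoffel (static_metric N g) b c d y = F y" for a b c d F
    using partial_deriv_cong_open[OF U that] .
  have dN: "partial_deriv j (\<lambda>y. partial_deriv l N y / N y) (space_part x) =
    partial_deriv j (partial_deriv l N) (space_part x) / N (space_part x)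
      - partial_deriv l N (space_part x) * partial_deriv j N (space_part x) / (N (space_part x))\<^sup>2" for l j
    by (rule partial_deriv_divide) (use diff diff2 N xS in auto)
  have D1: "partial_deriv None (christoffel (static_metric N g) None (Some j) (Some l)) x = 0" for j l
    using pd[OF chr(4)] by simp
  have D2: "partial_deriv (Some j) (christoffel (static_metric N g) None None (Some l)) x =
      partial_deriv j (partial_deriv l N) (space_part x) / N (space_part x)
      - partial_deriv l N (space_part x) * partial_deriv j N (space_part x) / (N (space_part x))\<^sup>2" for j l
    unfolding dN[symmetric]
    by (rule trans[OF pd[OF chr(2)] partial_deriv_space_part(1)[of j "\<lambda>y. partial_deriv l N y / N y"]])
  have D3: "partial_deriv (Some j) (christoffel (static_metric N g) (Some a) (Some b) (Some c)) x =
      partial_deriv j (christoffel g a b c) (space_part x)" for j a b c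
    using pd[OF chr(8)] by simp
  have D4: "partial_deriv (Some j) (christoffel (static_metric N g) (Some p) None None) x =
      partial_deriv j N (space_part x) * gradient g N p (space_part x)
      + N (space_part x) * partial_deriv j (gradient g N p) (space_part x)" for j p
  proof -
    have "partial_deriv j (\<lambda>y. N y * gradient g N p y) (space_part x) =
        partial_deriv j N (space_part x) * gradient g N p (space_part x)
      + N (space_part x) * partial_deriv j (gradient g N p) (space_part x)"
      by (rule partial_deriv_mult) (use diff diffW xS in auto)
    then show ?thesis
      using trans[OF pd[OF chr(5)] partial_deriv_space_part(1)[of j "\<lambda>y. N y * gradient g N p y"]]
      by simp
  qed
  have D5: "partial_deriv None (christoffel (static_metric N g) (Some p) (Some q) None) x = 0" for p q
    using pd[OF chr(7)] by simp
  note chrx = chr[OF U(2)]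
  have Nx: "N (space_part x) \<noteq> 0" using N xS by blast
  have R1: "riemann (static_metric N g) None (Some l) None (Some j) x =
      - hessian g N l j (space_part x) / N (space_part x)"
  proof -
    have "riemann (static_metric N g) None (Some l) None (Some j) x =
      - (partial_deriv j (partial_deriv l N) (space_part x) / N (space_part x))
      + (\<Sum>m\<in>UNIV. partial_deriv m N (space_part x) / N (space_part x) * christoffel g m j l (space_part x))"
      unfolding riemann_def D1 D2 sum_UNIV_option chrx by (simp add: power2_eq_square)
    also have "(\<Sum>m\<in>UNIV. partial_deriv m N (space_part x) / N (space_part x) * christoffel g m j l (space_part x)) =
       (\<Sum>m\<in>UNIV. christoffel g m j l (space_part x) * partial_deriv m N (space_part x)) / N (space_part x)"
      by (simp add: sum_divide_distrib mult_ac)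
    finally show ?thesis by (simp add: hessian_def diff_divide_distrib)
  qed
  have R2: "riemann (static_metric N g) (Some p) (Some l) (Some p) (Some j) x =
      riemann g p l p j (space_part x)" for p
    unfolding riemann_def D3 sum_UNIV_option chrx by simp
  show "ricci (static_metric N g) x $ Some l $ Some j =
      ricci g (space_part x) $ l $ j - hessian g N l j (space_part x) / N (space_part x)"
    by (simp add: ricci_def sum_UNIV_option R1 R2)
  have R3: "riemann (static_metric N g) None None None None x = 0"
    by (simp add: riemann_def)
  have R4: "riemann (static_metric N g) (Some p) None (Some p) None x = N (space_part x) *
     (partial_deriv p (gradient g N p) (space_part x)
     + (\<Sum>q\<in>UNIV. christoffel g p p q (space_part x) * gradient g N q (space_part x)))" for p
    unfolding riemann_def D4 D5 sum_UNIV_option chrx using Nx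
    by (simp add: sum_distrib_left distrib_left mult_ac)
  show "ricci (static_metric N g) x $ None $ None =
      N (space_part x) * laplacian g N (space_part x)"
    by (simp add: ricci_def sum_UNIV_option R3 R4 laplacian_def sum_distrib_left)
qed

section \<open>The trace of the Einstein equation\<close>

text \<open>The equation makes \<open>Ric\<close> a multiple \<open>\<mu> g\<close> with \<open>\<mu> = Scal/2 - \<Lambda>\<close>, and the trace
  \<open>Scal = CARD('m) \<mu>\<close> then determines \<open>\<mu>\<close>.\<close>

lemma vacuum_einstein_imp_ricci:
  fixes g :: "real^'m::finite \<Rightarrow> real^'m^'m"
  assumes ein: "vacuum_einstein_on U \<Lambda> g" and x: "x \<in> U" and inv: "invertible (g x)"
    and sym: "transpose (g x) = g x" and card: "CARD('m) > 2"
  shows "ricci g x = (2 * \<Lambda> / (real CARD('m) - 2)) *\<^sub>R g x"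
proof -
  define \<mu> where "\<mu> = (1/2) * scalar_curvature g x - \<Lambda>"
  have ric: "ricci g x = \<mu> *\<^sub>R g x"
    using ein x by (simp add: vacuum_einstein_on_def \<mu>_def algebra_simps)
  have "matrix_inv (g x) ** g x = mat 1" by (rule invertible_matrix_inv[OF inv])
  then have "(\<Sum>j\<in>UNIV. matrix_inv (g x) $ i $ j * g x $ j $ i) = 1" for i
    by (simp add: matrix_matrix_mult_def vec_eq_iff mat_def)
  moreover have "g x $ i $ j = g x $ j $ i" for i j
    using sym by (simp add: transpose_def vec_eq_iff)
  then have "(\<lambda>j. matrix_inv (g x) $ i $ j * g x $ i $ j) = (\<lambda>j. matrix_inv (g x) $ i $ j * g x $ j $ i)" for i
    by (intro ext) metis
  ultimately have *: "(\<Sum>j\<in>UNIV. matrix_inv (g x) $ i $ j * g x $ i $ j) = 1" for i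
    by presburger
  have "scalar_curvature g x = (\<Sum>i\<in>UNIV. \<mu> * (\<Sum>j\<in>UNIV. matrix_inv (g x) $ i $ j * g x $ i $ j))"
    unfolding scalar_curvature_def ric by (simp add: sum_distrib_left mult_ac)
  also have "\<dots> = real CARD('m) * \<mu>" by (simp add: *)
  finally have "\<mu> * (real CARD('m) - 2) = scalar_curvature g x - 2 * \<mu>"
    by (simp add: right_diff_distrib mult.commute)
  then have "\<mu> * (real CARD('m) - 2) = 2 * \<Lambda>"
    using \<mu>_def by simp
  then have "\<mu> = 2 * \<Lambda> / (real CARD('m) - 2)" using card by (simp add: field_simps)
  then show ?thesis using ric by simp
qed

section \<open>The Ricci curvature of the spatial metric\<close>

lemma sum_UNIV_space_coord:
  "(\<Sum>i\<in>UNIV. f i) = f Rad + f Ang + (\<Sum>i\<in>UNIV. f (Tor i))"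
  for f :: "'k::finite space_coord \<Rightarrow> real"
proof -
  have U: "UNIV = insert Rad (insert Ang (range (Tor :: 'k \<Rightarrow> _)))"
    by (auto intro: space_coord.exhaust)
  show ?thesis unfolding U by (subst sum.insert; auto simp: sum.reindex inj_def)+
qed

lemma CARD_space_coord: "CARD('k::finite space_coord) = CARD('k) + 2"
proof -
  have "real CARD('k space_coord) = (\<Sum>i\<in>(UNIV::'k space_coord set). 1)" by simp
  also have "\<dots> = real (CARD('k) + 2)" unfolding sum_UNIV_space_coord by simp
  finally show ?thesis by (simp only: of_nat_eq_iff)
qed

text \<open>The Christoffel symbols \<open>\<Gamma>\<^sup>a\<^sub>b\<^sub>c\<close> of the spatial metric depend only on \<open>r\<close>. Values are
  functions rather than reals, since it is their derivative that enters the curvature.\<close>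

fun christoffel_coeff ::
    "(real \<Rightarrow> real) \<Rightarrow> (real \<Rightarrow> real) \<Rightarrow> 'k space_coord \<Rightarrow> 'k space_coord \<Rightarrow> 'k space_coord \<Rightarrow> real \<Rightarrow> real"
  where
    "christoffel_coeff V V' Rad Rad Rad = (\<lambda>r. - V' r / (2 * V r))"
  | "christoffel_coeff V V' Rad Ang Ang = (\<lambda>r. - V r * V' r / 2)"
  | "christoffel_coeff V V' Rad (Tor i) (Tor j) = (\<lambda>r. (if i = j then - r * V r else 0))"
  | "christoffel_coeff V V' Ang Rad Ang = (\<lambda>r. V' r / (2 * V r))"
  | "christoffel_coeff V V' Ang Ang Rad = (\<lambda>r. V' r / (2 * V r))"
  | "christoffel_coeff V V' (Tor i) Rad (Tor j) = (\<lambda>r. (if i = j then 1 / r else 0))"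
  | "christoffel_coeff V V' (Tor i) (Tor j) Rad = (\<lambda>r. (if i = j then 1 / r else 0))"
  | "christoffel_coeff V V' _ _ _ = (\<lambda>r. 0)"

locale metric_profile =
  fixes V V' V'' :: "real \<Rightarrow> real" and \<rho> :: real
  assumes rho_nonneg: "\<rho> \<ge> 0"
    and V_nonzero: "r > \<rho> \<Longrightarrow> V r \<noteq> 0"
    and V_deriv: "r > \<rho> \<Longrightarrow> (V has_real_derivative V' r) (at r)"
    and V'_deriv: "r > \<rho> \<Longrightarrow> (V' has_real_derivative V'' r) (at r)"
begin

definition chart :: "(real^('k::finite space_coord)) set" where
  "chart = {x. x $ Rad > \<rho>}"

lemma open_chart: "open chart"
  unfolding chart_def by (intro open_Collect_less continuous_intros)

lemma spatial_metric_inverse: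
  fixes x :: "real^('k::finite space_coord)"
  assumes "x \<in> chart"
  shows "spatial_metric V x ** (\<chi> i j. if i = j then
     (case i of Rad \<Rightarrow> V (x $ Rad) | Ang \<Rightarrow> 1 / V (x $ Rad) | Tor _ \<Rightarrow> 1 / (x $ Rad)\<^sup>2) else 0) = mat 1"
proof -
  have "V (x $ Rad) \<noteq> 0" "x $ Rad \<noteq> 0"
    using V_nonzero rho_nonneg assms by (auto simp: chart_def)
  then have *: "(case i of Rad \<Rightarrow> 1 / V (x $ Rad) | Ang \<Rightarrow> V (x $ Rad) | Tor _ \<Rightarrow> (x $ Rad)\<^sup>2) *
    (case i of Rad \<Rightarrow> V (x $ Rad) | Ang \<Rightarrow> 1 / V (x $ Rad) | Tor _ \<Rightarrow> 1 / (x $ Rad)\<^sup>2) = 1"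
    for i :: "'k space_coord" by (cases i) auto
  have "spatial_metric V x = (\<chi> i j. if i = j then
     (case i of Rad \<Rightarrow> 1 / V (x $ Rad) | Ang \<Rightarrow> V (x $ Rad) | Tor _ \<Rightarrow> (x $ Rad)\<^sup>2) else 0)"
    by (simp add: spatial_metric_def vec_eq_iff)
  then show ?thesis using diagonal_matrix_mult[OF *] by simp
qed

lemma invertible_spatial_metric: "x \<in> chart \<Longrightarrow> invertible (spatial_metric V x)"
  using spatial_metric_inverse invertible_right_inverse by blast

lemma partial_deriv_spatial_metric:
  fixes x :: "real^('k::finite space_coord)"
  assumes "x \<in> chart"
  shows "partial_deriv p (\<lambda>y. spatial_metric V y $ i $ j) x = (if p = Rad \<and> i = j then
    (case i of Rad \<Rightarrow> - V' (x $ Rad) / (V (x $ Rad))\<^sup>2 | Ang \<Rightarrow> V' (x $ Rad) | Tor _ \<Rightarrow> 2 * x $ Rad) else 0)"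
proof (cases "i = j")
  case True
  have r: "V (x $ Rad) \<noteq> 0" "(V has_real_derivative V' (x $ Rad)) (at (x $ Rad))"
    using V_nonzero V_deriv assms by (auto simp: chart_def)
  have Q: "partial_deriv p (\<lambda>y. 1 / V (y $ Rad)) x = (if p = Rad then - V' (x $ Rad) / (V (x $ Rad))\<^sup>2 else 0)"
    by (rule partial_deriv_coordinate) (use r in \<open>auto intro!: derivative_eq_intros simp: power2_eq_square\<close>)
  have Q2: "partial_deriv p (\<lambda>y. (y $ Rad)\<^sup>2) x = (if p = Rad then 2 * x $ Rad else 0)"
    by (rule partial_deriv_coordinate[where F = "\<lambda>r. r\<^sup>2"]) (auto intro!: derivative_eq_intros)
  show ?thesis using True Q Q2 partial_deriv_coordinate[OF r(2), of p]
    by (cases j) (simp_all add: spatial_metric_def)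
next
  case False
  then show ?thesis by (simp add: spatial_metric_def)
qed

lemma christoffel_spatial:
  fixes x :: "real^('k::finite space_coord)"
  assumes x: "x \<in> chart"
  shows "christoffel (spatial_metric V) a b c x = christoffel_coeff V V' a b c (x $ Rad)"
proof -
  define d where "d i = (case i of Rad \<Rightarrow> V (x $ Rad) | Ang \<Rightarrow> 1 / V (x $ Rad) | Tor _ \<Rightarrow> 1 / (x $ Rad)\<^sup>2)"
    for i :: "'k space_coord"
  have nz: "V (x $ Rad) \<noteq> 0" "x $ Rad \<noteq> 0"
    using V_nonzero rho_nonneg assms by (auto simp: chart_def)
  have "matrix_inv (spatial_metric V x) = (\<chi> i j. if i = j then d i else 0)"
    unfolding d_def by (rule matrix_inv_eqI[OF spatial_metric_inverse[OF x]])
  then have "christoffel (spatial_metric V) a b c x = (1/2) * (d a *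
     (partial_deriv b (\<lambda>y. spatial_metric V y $ c $ a) x + partial_deriv c (\<lambda>y. spatial_metric V y $ b $ a) x
        - partial_deriv a (\<lambda>y. spatial_metric V y $ b $ c) x))"
    unfolding christoffel_def by (simp add: if_distrib[of "\<lambda>t. t * _"] cong: if_cong)
  also have "\<dots> = christoffel_coeff V V' a b c (x $ Rad)"
    unfolding partial_deriv_spatial_metric[OF x] using nz
    by (cases a; cases b; cases c) (auto simp: d_def power2_eq_square)
  finally show ?thesis .
qed

fun christoffel_coeff_deriv ::
    "'k space_coord \<Rightarrow> 'k space_coord \<Rightarrow> 'k space_coord \<Rightarrow> real \<Rightarrow> real"
  where
    "christoffel_coeff_deriv Rad Rad Rad r = - (V'' r * V r - (V' r)\<^sup>2) / (2 * (V r)\<^sup>2)"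
  | "christoffel_coeff_deriv Rad Ang Ang r = - ((V' r)\<^sup>2 + V r * V'' r) / 2"
  | "christoffel_coeff_deriv Rad (Tor i) (Tor j) r = (if i = j then - V r - r * V' r else 0)"
  | "christoffel_coeff_deriv Ang Rad Ang r = (V'' r * V r - (V' r)\<^sup>2) / (2 * (V r)\<^sup>2)"
  | "christoffel_coeff_deriv Ang Ang Rad r = (V'' r * V r - (V' r)\<^sup>2) / (2 * (V r)\<^sup>2)"
  | "christoffel_coeff_deriv (Tor i) Rad (Tor j) r = (if i = j then - 1 / r\<^sup>2 else 0)"
  | "christoffel_coeff_deriv (Tor i) (Tor j) Rad r = (if i = j then - 1 / r\<^sup>2 else 0)"
  | "christoffel_coeff_deriv _ _ _ r = 0"

lemma christoffel_coeff_has_deriv: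
  assumes "r > \<rho>"
  shows "(christoffel_coeff V V' a b c has_real_derivative christoffel_coeff_deriv a b c r) (at r)"
proof -
  have nz: "V r \<noteq> 0" "r \<noteq> 0" and d: "(V has_real_derivative V' r) (at r)"
      "(V' has_real_derivative V'' r) (at r)"
    using V_nonzero rho_nonneg V_deriv V'_deriv assms by auto
  have 1: "((\<lambda>r. V' r / (2 * V r)) has_real_derivative (V'' r * V r - (V' r)\<^sup>2) / (2 * (V r)\<^sup>2)) (at r)"
    using nz by (auto intro!: derivative_eq_intros d simp: field_simps power2_eq_square)
  have 2: "((\<lambda>r. - V' r / (2 * V r)) has_real_derivative - (V'' r * V r - (V' r)\<^sup>2) / (2 * (V r)\<^sup>2)) (at r)"
    using DERIV_minus[OF 1] by (simp only: minus_divide_left)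
  have 3: "((\<lambda>r. - V r * V' r / 2) has_real_derivative - ((V' r)\<^sup>2 + V r * V'' r) / 2) (at r)"
    by (auto intro!: derivative_eq_intros d simp: field_simps power2_eq_square)
  have 4: "((\<lambda>r. - r * V r) has_real_derivative - V r - r * V' r) (at r)"
    by (auto intro!: derivative_eq_intros d)
  have 5: "((\<lambda>r. 1 / r) has_real_derivative - 1 / r\<^sup>2) (at r)"
    using nz by (auto intro!: derivative_eq_intros simp: power2_eq_square)
  show ?thesis
    by (cases a; cases b; cases c)
      (simp_all only: christoffel_coeff.simps christoffel_coeff_deriv.simps 1 2 3 4 5 DERIV_const
        if_True if_False split: if_split, simp_all add: 4 5[simplified] 4[simplified])
qed

lemma partial_deriv_christoffel_spatial:
  fixes x :: "real^('k::finite space_coord)"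
  assumes x: "x \<in> chart"
  shows "partial_deriv p (christoffel (spatial_metric V) a b c) x =
    (if p = Rad then christoffel_coeff_deriv a b c (x $ Rad) else 0)"
proof -
  have "partial_deriv p (christoffel (spatial_metric V) a b c) x =
     partial_deriv p (\<lambda>y. christoffel_coeff V V' a b c (y $ Rad)) x"
    by (rule partial_deriv_cong_open[OF open_chart x]) (rule christoffel_spatial)
  also have "\<dots> = (if p = Rad then christoffel_coeff_deriv a b c (x $ Rad) else 0)"
    by (rule partial_deriv_coordinate) (use christoffel_coeff_has_deriv x in \<open>auto simp: chart_def\<close>)
  finally show ?thesis .
qed

lemma ricci_spatial:
  fixes x :: "real^('k::finite space_coord)"
  assumes x: "x \<in> chart"
  defines "r \<equiv> x $ Rad" and "k \<equiv> real CARD('k)"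
  shows "ricci (spatial_metric V) x $ Rad $ Rad = (- V'' r / 2 - k * V' r / (2 * r)) / V r"
    "ricci (spatial_metric V) x $ Ang $ Ang = (- V'' r / 2 - k * V' r / (2 * r)) * V r"
    "ricci (spatial_metric V) x $ Tor i $ Tor i = - r * V' r - (k - 1) * V r"
    "ricci (spatial_metric V) x $ Rad $ Ang = 0"
    "ricci (spatial_metric V) x $ Tor i $ Ang = 0"
proof -
  have nz: "V r \<noteq> 0" "r \<noteq> 0"
    using V_nonzero rho_nonneg x by (auto simp: chart_def r_def)
  \<comment> \<open>contracts the two Kronecker deltas in products of Christoffel symbols with toral indices\<close>
  have delta: "(if p = q then a else 0) * (if q = p then b else 0) = (if q = p then a * b else 0)"
    for p q :: 'k and a b :: real by simp
  note defs = delta sum_negf ricci_def riemann_def partial_deriv_christoffel_spatial[OF x] christoffel_spatial[OF x]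
    sum_UNIV_space_coord r_def[symmetric]
  show "ricci (spatial_metric V) x $ Rad $ Rad = (- V'' r / 2 - k * V' r / (2 * r)) / V r"
    using nz by (simp add: defs k_def) (simp add: field_simps power2_eq_square)
  show "ricci (spatial_metric V) x $ Ang $ Ang = (- V'' r / 2 - k * V' r / (2 * r)) * V r"
    using nz by (simp add: defs k_def) (simp add: field_simps power2_eq_square)
  show "ricci (spatial_metric V) x $ Tor i $ Tor i = - r * V' r - (k - 1) * V r"
    using nz by (simp add: defs k_def if_distrib[of "\<lambda>t. t * _"] if_distrib[of "\<lambda>t. _ * t"] cong: if_cong) (simp add: field_simps power2_eq_square sum_subtractf sum_negf)
  show "ricci (spatial_metric V) x $ Rad $ Ang = 0"
    by (simp add: defs)
  show "ricci (spatial_metric V) x $ Tor i $ Ang = 0"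
    by (simp add: defs)
qed

lemma matrix_inv_spatial:
  fixes x :: "real^('k::finite space_coord)"
  assumes "x \<in> chart"
  shows "matrix_inv (spatial_metric V x) $ i $ j = (if i = j then
     (case i of Rad \<Rightarrow> V (x $ Rad) | Ang \<Rightarrow> 1 / V (x $ Rad) | Tor _ \<Rightarrow> 1 / (x $ Rad)\<^sup>2) else 0)"
  unfolding matrix_inv_eqI[OF spatial_metric_inverse[OF assms]] by simp

lemma gradient_spatial:
  fixes x :: "real^('k::finite space_coord)"
  assumes "x \<in> chart"
  shows "gradient (spatial_metric V) N p x =
    (case p of Rad \<Rightarrow> V (x $ Rad) | Ang \<Rightarrow> 1 / V (x $ Rad) | Tor _ \<Rightarrow> 1 / (x $ Rad)\<^sup>2) *
      partial_deriv p N x"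
  unfolding gradient_def matrix_inv_spatial[OF assms]
  by (simp add: if_distrib[of "\<lambda>t. t * _"] cong: if_cong)

lemma hessian_spatial:
  fixes x :: "real^('k::finite space_coord)"
  assumes x: "x \<in> chart"
  defines "r \<equiv> x $ Rad"
  shows "hessian (spatial_metric V) N Rad Rad x =
      partial_deriv Rad (partial_deriv Rad N) x + V' r / (2 * V r) * partial_deriv Rad N x"
    "hessian (spatial_metric V) N Ang Ang x =
      partial_deriv Ang (partial_deriv Ang N) x + V r * V' r / 2 * partial_deriv Rad N x"
    "hessian (spatial_metric V) N (Tor i) (Tor i) x =
      partial_deriv (Tor i) (partial_deriv (Tor i) N) x + r * V r * partial_deriv Rad N x"
    "hessian (spatial_metric V) N Rad Ang x =
      partial_deriv Ang (partial_deriv Rad N) x - V' r / (2 * V r) * partial_deriv Ang N x"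
    "hessian (spatial_metric V) N (Tor i) Ang x = partial_deriv Ang (partial_deriv (Tor i) N) x"
  by (simp_all add: hessian_def christoffel_spatial[OF x] sum_UNIV_space_coord r_def[symmetric])

definition inverse_coeff :: "'k space_coord \<Rightarrow> real \<Rightarrow> real" where
  "inverse_coeff p = (case p of Rad \<Rightarrow> V | Ang \<Rightarrow> (\<lambda>r. 1 / V r) | Tor _ \<Rightarrow> (\<lambda>r. 1 / r\<^sup>2))"

definition inverse_coeff' :: "'k space_coord \<Rightarrow> real \<Rightarrow> real" where
  "inverse_coeff' p = (case p of Rad \<Rightarrow> V' | Ang \<Rightarrow> (\<lambda>r. - V' r / (V r)\<^sup>2) | Tor _ \<Rightarrow> (\<lambda>r. - 2 / r ^ 3))"

lemma inverse_coeff_has_deriv: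
  "r > \<rho> \<Longrightarrow> (inverse_coeff p has_real_derivative inverse_coeff' p r) (at r)"
  using V_nonzero[of r] rho_nonneg V_deriv[of r]
  by (cases p) (auto simp: inverse_coeff_def inverse_coeff'_def intro!: derivative_eq_intros
    simp: power2_eq_square power3_eq_cube)

lemma
  fixes N :: "real^('k::finite space_coord) \<Rightarrow> real"
  assumes smooth: "smooth_on chart N" and x: "x \<in> chart"
  shows gradient_differentiable: "gradient (spatial_metric V) N p differentiable (at x)"
    and partial_deriv_gradient: "partial_deriv q (gradient (spatial_metric V) N p) x =
     (if q = Rad then inverse_coeff' p (x $ Rad) else 0) * partial_deriv p N x
      + inverse_coeff p (x $ Rad) * partial_deriv q (partial_deriv p N) x"
proof -
  have eq: "gradient (spatial_metric V) N p y = inverse_coeff p (y $ Rad) * partial_deriv p N y"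
    if "y \<in> chart" for y
    using gradient_spatial[OF that] by (cases p) (simp_all add: inverse_coeff_def)
  have r: "x $ Rad > \<rho>" using x by (simp add: chart_def)
  have 1: "(\<lambda>y. inverse_coeff p (y $ Rad)) differentiable (at x)"
    by (rule differentiable_coordinate[OF inverse_coeff_has_deriv[OF r]])
  have 2: "partial_deriv p N differentiable (at x)"
    using smooth_on_imp(2)[OF smooth open_chart x] .
  obtain D where "((\<lambda>y. inverse_coeff p (y $ Rad) * partial_deriv p N y) has_derivative D) (at x)"
    using differentiable_mult[OF 1 2] unfolding differentiable_def by blast
  then have "(gradient (spatial_metric V) N p has_derivative D) (at x)"
    by (rule has_derivative_transform_within_open[OF _ open_chart x]) (simp add: eq)
  then show "gradient (spatial_metric V) N p differentiable (at x)"
    unfolding differentiable_def by blast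
  show "partial_deriv q (gradient (spatial_metric V) N p) x =
     (if q = Rad then inverse_coeff' p (x $ Rad) else 0) * partial_deriv p N x
      + inverse_coeff p (x $ Rad) * partial_deriv q (partial_deriv p N) x"
    using partial_deriv_cong_open[OF open_chart x eq, of "\<lambda>y. y" q] partial_deriv_mult[OF 1 2, of q]
      partial_deriv_coordinate[OF inverse_coeff_has_deriv[OF r], of q p] by simp
qed

text \<open>The divergence of the gradient is the metric trace of the Hessian; for a diagonal metric this
  expresses it through the components that the Einstein equation controls.\<close>

lemma laplacian_spatial:
  fixes N :: "real^('k::finite space_coord) \<Rightarrow> real"
  assumes smooth: "smooth_on chart N" and x: "x \<in> chart"
  defines "r \<equiv> x $ Rad"
  shows "laplacian (spatial_metric V) N x =
     V r * hessian (spatial_metric V) N Rad Rad x + hessian (spatial_metric V) N Ang Ang x / V r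
     + (\<Sum>i\<in>UNIV. hessian (spatial_metric V) N (Tor i) (Tor i) x) / r\<^sup>2"
proof -
  have nz: "V r \<noteq> 0" "r \<noteq> 0"
    using V_nonzero rho_nonneg x by (auto simp: chart_def r_def)
  show ?thesis
    unfolding laplacian_def partial_deriv_gradient[OF smooth x] gradient_spatial[OF x]
      hessian_spatial[OF x] christoffel_spatial[OF x] sum_UNIV_space_coord r_def[symmetric]
    using nz
    by (simp add: inverse_coeff_def inverse_coeff'_def sum.distrib sum_divide_distrib[symmetric])
      (simp add: field_simps power2_eq_square)
qed

end

section \<open>The static vacuum equations\<close>

locale static_vacuum = metric_profile V V' V'' \<rho>
  for V V' V'' :: "real \<Rightarrow> real" and \<rho> :: real +
  fixes N :: "real^('k::finite space_coord) \<Rightarrow> real" and \<Lambda> \<mu> :: real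
  assumes N_positive: "x \<in> chart \<Longrightarrow> N x > 0"
    and N_smooth: "smooth_on chart N"
    and einstein: "vacuum_einstein_on {x. x $ Some Rad > \<rho>} \<Lambda> (static_metric N (spatial_metric V))"
    and mu_def: "\<mu> = 2 * \<Lambda> / (real CARD('k) + 1)"
begin

lemma N_differentiable:
  assumes "x \<in> chart"
  shows "N differentiable (at x)" "partial_deriv i N differentiable (at x)"
  using smooth_on_imp[OF N_smooth open_chart assms] .

lemma ricci_static_eq:
  fixes y :: "real^('k space_coord)"
  assumes y: "y \<in> chart"
  shows "N y * ricci (spatial_metric V) y $ l $ j - hessian (spatial_metric V) N l j y =
      \<mu> * N y * spatial_metric V y $ l $ j"
    "laplacian (spatial_metric V) N y = - \<mu> * N y"
proof -
  define x :: "real^('k space_coord option)" where "x = (\<chi> i. case i of None \<Rightarrow> 0 | Some p \<Rightarrow> y $ p)"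
  have sp: "space_part x = y" by (simp add: space_part_def x_def vec_eq_iff)
  have xU: "x \<in> {x. x $ Some Rad > \<rho>}" using y by (simp add: x_def chart_def)
  have Ny: "N y > 0" using N_positive y .
  have inv: "invertible (static_metric N (spatial_metric V) x)"
    by (rule invertible_static_metric) (use invertible_spatial_metric[OF y] Ny sp in auto)
  have sym: "transpose (static_metric N (spatial_metric V) x) = static_metric N (spatial_metric V) x"
    unfolding vec_eq_iff
  proof (intro allI)
    fix i j
    show "transpose (static_metric N (spatial_metric V) x) $ i $ j = static_metric N (spatial_metric V) x $ i $ j"
      by (cases i; cases j) (auto simp: transpose_def spatial_metric_def)
  qed
  have card: "CARD('k space_coord option) = CARD('k) + 3"
    by (simp add: card_UNIV_option CARD_space_coord)
  have ric: "ricci (static_metric N (spatial_metric V)) x = \<mu> *\<^sub>R static_metric N (spatial_metric V) x"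
    using vacuum_einstein_imp_ricci[OF einstein xU inv sym] card by (simp add: mu_def add.commute)
  note S = ricci_static[where g = "spatial_metric V" and N = N and x = x, OF open_chart, unfolded sp,
    OF y invertible_spatial_metric less_imp_neq[OF N_positive, symmetric] N_differentiable(1,2) gradient_differentiable[OF N_smooth]]
  show "laplacian (spatial_metric V) N y = - \<mu> * N y"
  proof -
    have "N y * (laplacian (spatial_metric V) N y + \<mu> * N y) = 0"
      using S(2) by (simp add: ric sp power2_eq_square distrib_left mult_ac)
    then show ?thesis using Ny by simp
  qed
  have "ricci (spatial_metric V) y $ l $ j - hessian (spatial_metric V) N l j y / N y =
      \<mu> * spatial_metric V y $ l $ j"
    using S(1)[of l j] by (simp add: ric sp)
  then show "N y * ricci (spatial_metric V) y $ l $ j - hessian (spatial_metric V) N l j y =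
      \<mu> * N y * spatial_metric V y $ l $ j"
    using Ny by (simp add: field_simps)
qed

text \<open>The trace of \<open>N Ric\<^sub>g - Hess N = \<mu> N g\<close> contains \<open>N\<close> differentiated only in \<open>\<Delta>N = - \<mu> N\<close>, so
  that \<open>N\<close> cancels. The left-hand side is \<open>r\<^sup>2 Scal\<^sub>g\<close>.\<close>

lemma scalar_curvature_eq:
  assumes r: "r > \<rho>"
  defines "k \<equiv> real CARD('k)"
  shows "- V'' r * r\<^sup>2 - 2 * k * r * V' r - k * (k - 1) * V r = (k + 1) * \<mu> * r\<^sup>2"
proof -
  define x :: "real^('k space_coord)" where "x = r *\<^sub>R axis Rad 1"
  have xr: "x $ Rad = r" by (simp add: x_def)
  then have x: "x \<in> chart" using r by (simp add: chart_def)
  have nz: "V r \<noteq> 0" "r \<noteq> 0" "N x > 0"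
    using V_nonzero rho_nonneg r N_positive[OF x] by auto
  note E = ricci_static_eq(1)[OF x]
  let ?H = "\<lambda>i. hessian (spatial_metric V) N i i x"
  define B where "B = - V'' r / 2 - k * V' r / (2 * r)"
  have "N x * (B / V r) - ?H Rad = \<mu> * N x / V r"
    using E[of Rad Rad] ricci_spatial(1)[OF x] by (simp add: xr spatial_metric_def k_def B_def)
  then have "?H Rad = (N x * B - \<mu> * N x) / V r" by (simp add: diff_divide_distrib)
  then have 1: "?H Rad * V r = N x * B - \<mu> * N x" using nz by simp
  have "N x * (B * V r) - ?H Ang = \<mu> * N x * V r"
    using E[of Ang Ang] ricci_spatial(2)[OF x] by (simp add: xr spatial_metric_def k_def B_def)
  then have "?H Ang = (N x * B - \<mu> * N x) * V r" by (simp add: left_diff_distrib mult.assoc)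
  then have 2: "?H Ang / V r = N x * B - \<mu> * N x" using nz by simp
  have "?H (Tor i) = N x * (- r * V' r - (k - 1) * V r) - \<mu> * N x * r\<^sup>2" for i
    using E[of "Tor i" "Tor i"] ricci_spatial(3)[OF x, of i]
    by (simp add: xr spatial_metric_def k_def)
  then have 3: "(\<Sum>i\<in>UNIV. ?H (Tor i)) = k * (N x * (- r * V' r - (k - 1) * V r) - \<mu> * N x * r\<^sup>2)"
    by (simp add: k_def)
  have "- \<mu> * N x = ?H Rad * V r + ?H Ang / V r + (\<Sum>i\<in>UNIV. ?H (Tor i)) / r\<^sup>2"
    using laplacian_spatial[OF N_smooth x] ricci_static_eq(2)[OF x] by (simp add: xr mult.commute)
  also have "\<dots> = N x * ((- V'' r * r\<^sup>2 - 2 * k * r * V' r - k * (k - 1) * V r) - (k + 2) * \<mu> * r\<^sup>2) / r\<^sup>2"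
    unfolding 1 2 3 B_def using nz by (simp add: field_simps power2_eq_square)
  finally have "N x * ((- V'' r * r\<^sup>2 - 2 * k * r * V' r - k * (k - 1) * V r) - (k + 1) * \<mu> * r\<^sup>2) = 0"
    using nz by (simp add: field_simps)
  then show ?thesis using nz by simp
qed

lemma
  assumes x: "x \<in> chart"
  defines "r \<equiv> x $ Rad" and "k \<equiv> real CARD('k)"
  shows angular_eq: "N x * (- V'' r / 2 - k * V' r / (2 * r) - \<mu>) * V r =
      partial_deriv Ang (partial_deriv Ang N) x + V r * V' r / 2 * partial_deriv Rad N x"
    and toral_eq: "N x * (- r * V' r - (k - 1) * V r - \<mu> * r\<^sup>2) =
      partial_deriv (Tor i) (partial_deriv (Tor i) N) x + r * V r * partial_deriv Rad N x"
    and radial_angular_eq: "partial_deriv Ang (partial_deriv Rad N) x = V' r / (2 * V r) * partial_deriv Ang N x"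
    and toral_angular_eq: "partial_deriv Ang (partial_deriv (Tor i) N) x = 0"
proof -
  note E = ricci_static_eq(1)[OF x]
  show "N x * (- V'' r / 2 - k * V' r / (2 * r) - \<mu>) * V r =
      partial_deriv Ang (partial_deriv Ang N) x + V r * V' r / 2 * partial_deriv Rad N x"
    using E[of Ang Ang] ricci_spatial(2)[OF x] hessian_spatial(2)[OF x, of N]
    by (simp add: r_def k_def spatial_metric_def algebra_simps)
  show "N x * (- r * V' r - (k - 1) * V r - \<mu> * r\<^sup>2) =
      partial_deriv (Tor i) (partial_deriv (Tor i) N) x + r * V r * partial_deriv Rad N x"
    using E[of "Tor i" "Tor i"] ricci_spatial(3)[OF x, of i] hessian_spatial(3)[OF x, of N i]
    by (simp add: r_def k_def spatial_metric_def algebra_simps)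
  show "partial_deriv Ang (partial_deriv Rad N) x = V' r / (2 * V r) * partial_deriv Ang N x"
    using E[of Rad Ang] ricci_spatial(4)[OF x] hessian_spatial(4)[OF x, of N]
    by (simp add: r_def k_def spatial_metric_def)
  show "partial_deriv Ang (partial_deriv (Tor i) N) x = 0"
    using E[of "Tor i" Ang] ricci_spatial(5)[OF x] hessian_spatial(5)[OF x, of N i]
    by (simp add: spatial_metric_def)
qed

lemma shift_in_chart [simp]: "p \<noteq> Rad \<Longrightarrow> x + s *\<^sub>R axis p 1 \<in> chart \<longleftrightarrow> x \<in> chart"
  by (simp add: chart_def axis_def)

lemma axis_Rad [simp]: "p \<noteq> Rad \<Longrightarrow> (axis p 1 :: real^('k space_coord)) $ Rad = 0"
  by (simp add: axis_def)

text \<open>The quantities \<open>\<partial>\<^sub>r N - V'/(2V) N\<close> and \<open>\<partial>\<^sub>\<theta> N\<close> are independent of \<open>\<phi>\<close> by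
  \<open>radial_angular_eq\<close> and \<open>toral_angular_eq\<close>. Hence the difference \<open>D\<close> of \<open>N\<close> at two values of \<open>\<phi>\<close> satisfies
  \<open>\<partial>\<^sub>r D = V'/(2V) D\<close> and \<open>\<partial>\<^sub>\<theta>\<partial>\<^sub>\<theta> D = 0\<close>, and subtracting the two copies of
  \<open>toral_eq\<close> leaves an algebraic equation for \<open>D\<close>. Working with differences in place of \<open>\<partial>\<^sub>\<phi> N\<close> avoids
  third derivatives and the exchange of partial derivatives.\<close>

lemma angular_shift:
  assumes x: "x \<in> chart"
  defines "r \<equiv> x $ Rad" and "k \<equiv> real CARD('k)"
  shows "(N (x + s *\<^sub>R axis Ang 1) - N x) *
      (- r * V' r - (k - 1) * V r - \<mu> * r\<^sup>2 - r * V' r / 2) = 0"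
proof -
  let ?e = "axis Ang 1 :: real^('k space_coord)"
  let ?M = "\<lambda>y. partial_deriv Rad N y - V' (y $ Rad) / (2 * V (y $ Rad)) * N y"
  have rx: "r > \<rho>" using x by (simp add: chart_def r_def)
  have Vr: "V r \<noteq> 0" using V_nonzero rx .
  have coeff: "((\<lambda>r. V' r / (2 * V r)) has_real_derivative
      (V'' (y $ Rad) * V (y $ Rad) - (V' (y $ Rad))\<^sup>2) / (2 * (V (y $ Rad))\<^sup>2)) (at (y $ Rad))"
    if "y \<in> chart" for y :: "real^('k space_coord)"
    using christoffel_coeff_has_deriv[of "y $ Rad" Ang Rad Ang] that by (simp add: chart_def)
  have Mdiff: "?M differentiable (at y)" if "y \<in> chart" for y
    by (intro differentiable_diff differentiable_mult N_differentiable that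
        differentiable_coordinate[OF coeff[OF that]])
  have M0: "partial_deriv Ang ?M y = 0" if y: "y \<in> chart" for y
  proof -
    note c = differentiable_coordinate[OF coeff[OF y]]
    have "partial_deriv Ang ?M y = partial_deriv Ang (partial_deriv Rad N) y
        - partial_deriv Ang (\<lambda>y. V' (y $ Rad) / (2 * V (y $ Rad)) * N y) y"
      by (rule partial_deriv_diff) (intro differentiable_mult N_differentiable c y)+
    then show ?thesis
      using partial_deriv_mult[OF c N_differentiable(1)[OF y], of Ang]
        partial_deriv_coordinate[OF coeff[OF y], of Ang] radial_angular_eq[OF y] by simp
  qed
  have M: "?M (x + s *\<^sub>R ?e) = ?M x"
    by (rule constant_along_line[of ?M]) (use Mdiff M0 x in auto)
  obtain i :: 'k where True by simp
  have T: "partial_deriv (Tor i) N (y + s *\<^sub>R ?e) = partial_deriv (Tor i) N y" if "y \<in> chart" for y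
    by (rule constant_along_line) (use toral_angular_eq that N_differentiable in auto)
  have "partial_deriv (Tor i) N (x + s *\<^sub>R ?e + t *\<^sub>R axis (Tor i) 1) =
      partial_deriv (Tor i) N (x + t *\<^sub>R axis (Tor i) 1)" for t
    using T[of "x + t *\<^sub>R axis (Tor i) 1"] x by (simp add: add_ac)
  then have TT: "partial_deriv (Tor i) (partial_deriv (Tor i) N) (x + s *\<^sub>R ?e) =
      partial_deriv (Tor i) (partial_deriv (Tor i) N) x"
    by (simp add: partial_deriv_def[of "Tor i" "partial_deriv (Tor i) N"])
  have x': "x + s *\<^sub>R ?e \<in> chart" using x by simp
  have 1: "(N (x + s *\<^sub>R ?e) - N x) * (- r * V' r - (k - 1) * V r - \<mu> * r\<^sup>2) =
     r * V r * (partial_deriv Rad N (x + s *\<^sub>R ?e) - partial_deriv Rad N x)"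
    using toral_eq[OF x, of i] toral_eq[OF x', of i] TT
    by (simp add: r_def k_def left_diff_distrib right_diff_distrib)
  have 2: "partial_deriv Rad N (x + s *\<^sub>R ?e) - partial_deriv Rad N x =
      V' r / (2 * V r) * (N (x + s *\<^sub>R ?e) - N x)"
    using M by (simp add: r_def right_diff_distrib)
  have "(N (x + s *\<^sub>R ?e) - N x) * (- r * V' r - (k - 1) * V r - \<mu> * r\<^sup>2) =
     r * V' r / 2 * (N (x + s *\<^sub>R ?e) - N x)"
    unfolding 1 2 using Vr by simp
  then show ?thesis
    using right_diff_distrib[of "N (x + s *\<^sub>R ?e) - N x" "- r * V' r - (k - 1) * V r - \<mu> * r\<^sup>2" "r * V' r / 2"]
    by (metis mult.commute eq_iff_diff_eq_0)
qed

end

section \<open>Uniqueness\<close>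

text \<open>The given family with \<open>n = m + 3\<close> and \<open>d = r\<^sub>0\<^sup>n\<close>. The conditions on \<open>V\<close> and its derivatives are
  multiplied by powers of \<open>r\<close> and by \<open>L\<^sup>2\<close>, so that \<open>r\<^sup>2\<close>, \<open>a r\<close>, \<open>d\<close> and the single inverse
  power of \<open>r\<close> are the only terms: every later equation becomes polynomial in these.\<close>

locale soliton_vacuum = static_vacuum V V' V'' \<rho> N \<Lambda> \<mu>
  for V V' V'' :: "real \<Rightarrow> real" and \<rho> :: real
    and N :: "real^('k::finite space_coord) \<Rightarrow> real" and \<Lambda> \<mu> :: real +
  fixes L a d :: real and m :: nat and P :: "'k \<Rightarrow> real"
  assumes card_torus: "CARD('k) = m + 1" and L_pos: "L > 0" and d_pos: "d > 0"
    and V_eq: "r > \<rho> \<Longrightarrow> L\<^sup>2 * V r = r\<^sup>2 + (a * r - d) / r ^ (m + 1)"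
    and V'_eq: "r > \<rho> \<Longrightarrow> L\<^sup>2 * (r * V' r) = 2 * r\<^sup>2 + ((m + 1) * d - m * a * r) / r ^ (m + 1)"
    and V''_eq: "r > \<rho> \<Longrightarrow> L\<^sup>2 * (r\<^sup>2 * V'' r) =
      2 * r\<^sup>2 + (m * (m + 1) * a * r - (m + 1) * (m + 2) * d) / r ^ (m + 1)"
    and P_pos: "P i > 0"
    and N_periodic: "x \<in> chart \<Longrightarrow> N (x + P i *\<^sub>R axis (Tor i) 1) = N x"
begin

lemma r_pos: "r > \<rho> \<Longrightarrow> r > 0"
  using rho_nonneg by simp

text \<open>In \<open>scalar_curvature_eq\<close> the terms with \<open>a\<close> and with \<open>d\<close> cancel, so a single radius decides.\<close>

lemma mu_eq: "\<mu> * L\<^sup>2 = - (real m + 3)"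
proof -
  define r where "r = \<rho> + 1"
  have r: "r > \<rho>" by (simp add: r_def)
  define w where "w = 1 / r ^ (m + 1)"
  have 1: "L\<^sup>2 * V r = r\<^sup>2 + (a * r - d) * w" "L\<^sup>2 * (r * V' r) = 2 * r\<^sup>2 + ((m + 1) * d - m * a * r) * w"
    "L\<^sup>2 * (r\<^sup>2 * V'' r) = 2 * r\<^sup>2 + (m * (m + 1) * a * r - (m + 1) * (m + 2) * d) * w"
    using V_eq[OF r] V'_eq[OF r] V''_eq[OF r] by (simp_all add: w_def)
  have "(real m + 2) * (\<mu> * L\<^sup>2) * r\<^sup>2 = L\<^sup>2 * ((real m + 2) * \<mu> * r\<^sup>2)" by (simp add: mult_ac)
  also have "(real m + 2) * \<mu> * r\<^sup>2 =
     - V'' r * r\<^sup>2 - 2 * (real m + 1) * r * V' r - (real m + 1) * real m * V r"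
    using scalar_curvature_eq[OF r] by (simp add: card_torus add.commute)
  also have "L\<^sup>2 * \<dots> = - (L\<^sup>2 * (r\<^sup>2 * V'' r)) - 2 * (real m + 1) * (L\<^sup>2 * (r * V' r)) - (real m + 1) * real m * (L\<^sup>2 * V r)"
    by (simp add: algebra_simps)
  also have "\<dots> = - ((real m + 2) * (real m + 3)) * r\<^sup>2"
    unfolding 1 by (simp add: algebra_simps)
  finally have "((real m + 2) * r\<^sup>2) * (\<mu> * L\<^sup>2 + (real m + 3)) = 0"
    by (simp add: algebra_simps)
  then have "\<mu> * L\<^sup>2 + (real m + 3) = 0"
    using r_pos[OF r] by simp
  then show ?thesis by simp
qed

lemma toral_coeff:
  assumes r: "r > \<rho>"
  shows "L\<^sup>2 * (- r * V' r - (real CARD('k) - 1) * V r - \<mu> * r\<^sup>2) = r\<^sup>2 - d / r ^ (m + 1)"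
proof -
  define w where "w = 1 / r ^ (m + 1)"
  have 1: "L\<^sup>2 * V r = r\<^sup>2 + (a * r - d) * w" "L\<^sup>2 * (r * V' r) = 2 * r\<^sup>2 + ((m + 1) * d - m * a * r) * w"
    using V_eq[OF r] V'_eq[OF r] by (simp_all add: w_def)
  have "L\<^sup>2 * (- r * V' r - (real CARD('k) - 1) * V r - \<mu> * r\<^sup>2) =
      - (L\<^sup>2 * (r * V' r)) - real m * (L\<^sup>2 * V r) - (\<mu> * L\<^sup>2) * r\<^sup>2"
    by (simp add: card_torus algebra_simps)
  also have "\<dots> = r\<^sup>2 - d * w"
    unfolding 1 mu_eq by (simp add: algebra_simps)
  finally show ?thesis by (simp add: w_def)
qed

lemma angular_coeff:
  assumes r: "r > \<rho>"
  shows "2 * L\<^sup>2 * r\<^sup>2 * (- V'' r / 2 - real CARD('k) * V' r / (2 * r) - \<mu>) =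
    2 * r\<^sup>2 + (m + 1) * d / r ^ (m + 1)"
proof -
  define w where "w = 1 / r ^ (m + 1)"
  have 1: "L\<^sup>2 * (r * V' r) = 2 * r\<^sup>2 + ((m + 1) * d - m * a * r) * w"
    "L\<^sup>2 * (r\<^sup>2 * V'' r) = 2 * r\<^sup>2 + (m * (m + 1) * a * r - (m + 1) * (m + 2) * d) * w"
    using V'_eq[OF r] V''_eq[OF r] by (simp_all add: w_def)
  have "2 * L\<^sup>2 * r\<^sup>2 * (- V'' r / 2 - real CARD('k) * V' r / (2 * r) - \<mu>) =
     - (L\<^sup>2 * (r\<^sup>2 * V'' r)) - (real m + 1) * (L\<^sup>2 * (r * V' r)) - 2 * (\<mu> * L\<^sup>2) * r\<^sup>2"
    using r_pos[OF r] by (simp add: card_torus field_simps power2_eq_square)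
  also have "\<dots> = 2 * r\<^sup>2 + (m + 1) * d * w"
    unfolding 1 mu_eq by (simp add: algebra_simps)
  finally show ?thesis by (simp add: w_def)
qed

text \<open>The factor in \<open>angular_shift\<close> is a positive multiple of \<open>m a r - (m + 3) d\<close>, whence the excluded radius.\<close>

lemma angular_derivative_zero_generic:
  assumes x: "x \<in> chart" and ne: "m * a * x $ Rad \<noteq> (m + 3) * d"
  shows "partial_deriv Ang N x = 0"
proof -
  define r where "r = x $ Rad"
  have r: "r > \<rho>" using x by (simp add: chart_def r_def)
  define w where "w = 1 / r ^ (m + 1)"
  have w: "w > 0" using r_pos[OF r] by (simp add: w_def)
  have "L\<^sup>2 * (- r * V' r - (real CARD('k) - 1) * V r - \<mu> * r\<^sup>2 - r * V' r / 2)
      = L\<^sup>2 * (- r * V' r - (real CARD('k) - 1) * V r - \<mu> * r\<^sup>2) - L\<^sup>2 * (r * V' r) / 2"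
    by (simp add: right_diff_distrib)
  also have "\<dots> = (m * a * r - (m + 3) * d) * w / 2"
  proof -
    have "L\<^sup>2 * (r * V' r) = 2 * r\<^sup>2 + ((m + 1) * d - m * a * r) * w"
      using V'_eq[OF r] by (simp add: w_def)
    moreover have "L\<^sup>2 * (- r * V' r - (real CARD('k) - 1) * V r - \<mu> * r\<^sup>2) = r\<^sup>2 - d * w"
      using toral_coeff[OF r] by (simp add: w_def)
    ultimately show ?thesis by (simp add: algebra_simps)
  qed
  also have "\<dots> \<noteq> 0" using ne w by (simp add: r_def)
  finally have "- r * V' r - (real CARD('k) - 1) * V r - \<mu> * r\<^sup>2 - r * V' r / 2 \<noteq> 0"
    by (metis mult_zero_right)
  then have "N (x + s *\<^sub>R axis Ang 1) = N x" for s
    using angular_shift[OF x, of s] by (simp add: r_def)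
  then show ?thesis by (simp add: partial_deriv_def)
qed

text \<open>The condition of \<open>angular_derivative_zero_generic\<close> fails for at most one radius, because
  \<open>d > 0\<close>; continuity in the radial direction covers that radius.\<close>

lemma angular_derivative_zero:
  assumes x: "x \<in> chart"
  shows "partial_deriv Ang N x = 0"
proof -
  let ?f = "\<lambda>s. partial_deriv Ang N (x + s *\<^sub>R axis Rad 1)"
  have "isCont ?f 0"
    using differentiable_has_partial_deriv[OF N_differentiable(2)[OF x]] by (rule DERIV_isCont)
  then have lim: "(?f \<longlongrightarrow> partial_deriv Ang N x) (at_right 0)"
    by (simp add: isCont_def filterlim_at_split)
  have "\<forall>\<^sub>F s in at_right 0. m * a * (x $ Rad + s) \<noteq> (m + 3) * d"
  proof (cases "m * a * x $ Rad = (m + 3) * d")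
    case True
    moreover have "(m + 3) * d > 0" using d_pos by simp
    ultimately have "real m * a \<noteq> 0" by (metis less_irrefl mult_zero_left)
    then have "m * a * (x $ Rad + s) \<noteq> (m + 3) * d" if "s > 0" for s
      using True that by (simp add: distrib_left)
    then show ?thesis by (auto simp: eventually_at_right_field intro: exI[of _ 1])
  next
    case False
    have "((\<lambda>s. m * a * (x $ Rad + s)) \<longlongrightarrow> m * a * (x $ Rad + 0)) (at_right 0)"
      by (intro tendsto_intros)
    then show ?thesis using False by (intro tendsto_imp_eventually_ne) auto
  qed
  then have "\<forall>\<^sub>F s in at_right 0. ?f s = 0"
    using eventually_at_right_less[of "0::real"]
  proof eventually_elim
    case (elim s)
    then show ?case using x by (intro angular_derivative_zero_generic) (auto simp: chart_def)
  qed
  then have "(?f \<longlongrightarrow> 0) (at_right 0)" by (rule tendsto_eventually)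
  then show ?thesis using lim tendsto_unique by (metis trivial_limit_at_right_real)
qed

lemma angular_eq_reduced:
  assumes x: "x \<in> chart"
  defines "r \<equiv> x $ Rad"
  shows "N x * (2 * r\<^sup>2 + (m + 1) * d / r ^ (m + 1)) =
    (2 * r\<^sup>2 + ((m + 1) * d - m * a * r) / r ^ (m + 1)) * (r * partial_deriv Rad N x)"
proof -
  have r: "r > \<rho>" using x by (simp add: chart_def r_def)
  have "partial_deriv Ang (partial_deriv Ang N) x = 0"
  proof -
    have "partial_deriv Ang (partial_deriv Ang N) x = partial_deriv Ang (\<lambda>_. 0) x"
      using open_chart x angular_derivative_zero by (rule partial_deriv_cong_open)
    then show ?thesis by simp
  qed
  have "N x * (- V'' r / 2 - real CARD('k) * V' r / (2 * r) - \<mu>) = V' r / 2 * partial_deriv Rad N x"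
  proof -
    define B where "B = - V'' r / 2 - real CARD('k) * V' r / (2 * r) - \<mu>"
    have "(N x * B) * V r = (V' r / 2 * partial_deriv Rad N x) * V r"
      using angular_eq[OF x] \<open>partial_deriv Ang (partial_deriv Ang N) x = 0\<close>
      unfolding r_def[symmetric] B_def[symmetric] by (simp add: mult_ac)
    then have "N x * B = V' r / 2 * partial_deriv Rad N x" using V_nonzero[OF r] by simp
    then show ?thesis by (simp only: B_def)
  qed
  then have "N x * (2 * L\<^sup>2 * r\<^sup>2 * (- V'' r / 2 - real CARD('k) * V' r / (2 * r) - \<mu>)) =
     (L\<^sup>2 * (r * V' r)) * (r * partial_deriv Rad N x)"
    by (simp add: power2_eq_square mult_ac)
  then show ?thesis unfolding angular_coeff[OF r] V'_eq[OF r] .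
qed

lemma toral_eq_reduced:
  assumes x: "x \<in> chart"
  defines "r \<equiv> x $ Rad"
  shows "L\<^sup>2 * partial_deriv (Tor i) (partial_deriv (Tor i) N) x =
    N x * (r\<^sup>2 - d / r ^ (m + 1)) - (r\<^sup>2 + (a * r - d) / r ^ (m + 1)) * (r * partial_deriv Rad N x)"
proof -
  have r: "r > \<rho>" using x by (simp add: chart_def r_def)
  have "L\<^sup>2 * partial_deriv (Tor i) (partial_deriv (Tor i) N) x =
     N x * (L\<^sup>2 * (- r * V' r - (real CARD('k) - 1) * V r - \<mu> * r\<^sup>2)) - (L\<^sup>2 * V r) * (r * partial_deriv Rad N x)"
  proof -
    define A where "A = - r * V' r - (real CARD('k) - 1) * V r - \<mu> * r\<^sup>2"
    have "partial_deriv (Tor i) (partial_deriv (Tor i) N) x = N x * A - r * V r * partial_deriv Rad N x"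
      using toral_eq[OF x, of i] unfolding r_def[symmetric] A_def[symmetric] by simp
    then show ?thesis unfolding A_def[symmetric] by (simp add: right_diff_distrib mult_ac)
  qed
  then show ?thesis unfolding toral_coeff[OF r] V_eq[OF r] .
qed

lemma toral_line_deriv:
  assumes "x \<in> chart"
  shows "((\<lambda>s. N (x + s *\<^sub>R axis (Tor i) 1)) has_real_derivative
      partial_deriv (Tor i) N (x + s *\<^sub>R axis (Tor i) 1)) (at s)"
    "((\<lambda>s. partial_deriv (Tor i) N (x + s *\<^sub>R axis (Tor i) 1)) has_real_derivative
      partial_deriv (Tor i) (partial_deriv (Tor i) N) (x + s *\<^sub>R axis (Tor i) 1)) (at s)"
  by (rule partial_deriv_along_line; use assms N_differentiable in simp)+

text \<open>Rolle's theorem on the circle of the coordinate \<open>\<theta>\<^sup>i\<close>.\<close>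

lemma toral_critical_point:
  assumes x: "x \<in> chart"
  obtains s where "partial_deriv (Tor i) N (x + s *\<^sub>R axis (Tor i) 1) = 0"
proof -
  obtain z where "N (x + P i *\<^sub>R axis (Tor i) 1) - N (x + 0 *\<^sub>R axis (Tor i) 1) =
      (P i - 0) * partial_deriv (Tor i) N (x + z *\<^sub>R axis (Tor i) 1)"
    using MVT2[OF P_pos[of i] toral_line_deriv(1)[OF x]] by blast
  then have "partial_deriv (Tor i) N (x + z *\<^sub>R axis (Tor i) 1) = 0"
    using N_periodic[OF x, of i] P_pos[of i] by simp
  then show ?thesis by (rule that)
qed

lemma toral_inflection_point:
  assumes x: "x \<in> chart"
  obtains s where "partial_deriv (Tor i) (partial_deriv (Tor i) N) (x + s *\<^sub>R axis (Tor i) 1) = 0"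
proof -
  have "N (x + P i *\<^sub>R axis (Tor i) 1 + s *\<^sub>R axis (Tor i) 1) = N (x + s *\<^sub>R axis (Tor i) 1)" for s
    using N_periodic[of "x + s *\<^sub>R axis (Tor i) 1" i] x by (simp add: add_ac)
  then have per: "partial_deriv (Tor i) N (x + P i *\<^sub>R axis (Tor i) 1) = partial_deriv (Tor i) N x"
    by (simp add: partial_deriv_def)
  obtain z where "partial_deriv (Tor i) N (x + P i *\<^sub>R axis (Tor i) 1) - partial_deriv (Tor i) N (x + 0 *\<^sub>R axis (Tor i) 1) =
      (P i - 0) * partial_deriv (Tor i) (partial_deriv (Tor i) N) (x + z *\<^sub>R axis (Tor i) 1)"
    using MVT2[OF P_pos[of i] toral_line_deriv(2)[OF x]] by blast
  then have "partial_deriv (Tor i) (partial_deriv (Tor i) N) (x + z *\<^sub>R axis (Tor i) 1) = 0"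
    using per P_pos[of i] by simp
  then show ?thesis by (rule that)
qed

text \<open>With \<open>u = r \<partial>\<^sub>r N\<close> the equations at a point where \<open>\<partial>\<^sub>\<theta>\<partial>\<^sub>\<theta> N\<close> vanishes read
  \<open>N Q = (Q - m a r w) u\<close> and \<open>N Y = (Y + a r w) u\<close>. Eliminating \<open>N\<close> and \<open>u\<close>, the product \<open>Q Y\<close> drops out and
  \<open>a r w (Q + m Y) = 0\<close> remains, and \<open>Q + m Y = (m + 2) r\<^sup>2 + d w\<close> is positive.\<close>

lemma a_zero: "a = 0"
proof -
  define x0 :: "real^('k space_coord)" where "x0 = (\<rho> + 1) *\<^sub>R axis Rad 1"
  have x0: "x0 \<in> chart" by (simp add: chart_def x0_def)
  obtain i :: 'k where True by simp
  obtain s where s: "partial_deriv (Tor i) (partial_deriv (Tor i) N) (x0 + s *\<^sub>R axis (Tor i) 1) = 0"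
    using toral_inflection_point[OF x0] by blast
  define x where "x = x0 + s *\<^sub>R axis (Tor i) 1"
  have x: "x \<in> chart" using x0 by (simp add: x_def)
  define r where "r = x $ Rad"
  have r: "r > \<rho>" using x by (simp add: chart_def r_def)
  note rp = r_pos[OF r]
  define w where "w = 1 / r ^ (m + 1)"
  have w: "w > 0" using rp by (simp add: w_def)
  define u where "u = r * partial_deriv Rad N x"
  define Q where "Q = 2 * r\<^sup>2 + (real m + 1) * d * w"
  define Y where "Y = r\<^sup>2 - d * w"
  have Np: "N x > 0" using N_positive x .
  have 1: "N x * Q = (Q - m * a * r * w) * u"
    using angular_eq_reduced[OF x] unfolding r_def[symmetric] u_def Q_def w_def
    by (simp add: diff_divide_distrib add_divide_distrib algebra_simps)
  have 2: "N x * Y = (Y + a * r * w) * u"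
    using toral_eq_reduced[OF x, of i] s unfolding r_def[symmetric] u_def Y_def w_def x_def[symmetric]
    by (simp add: diff_divide_distrib algebra_simps)
  have "Q > 0" using rp w d_pos by (simp add: Q_def add_pos_pos)
  then have u: "u \<noteq> 0" using 1 Np by auto
  have "N x * Y * (N x * Q) = N x * Q * (N x * Y)" by simp
  then have "N x * Y * ((Q - m * a * r * w) * u) = N x * Q * ((Y + a * r * w) * u)"
    using 1 2 by simp
  then have "N x * u * (a * r * w * (Q + m * Y)) = 0"
    by (simp add: algebra_simps)
  then have "a = 0 \<or> Q + m * Y = 0" using Np u rp w by simp
  moreover have "Q + m * Y = (real m + 2) * r\<^sup>2 + d * w"
    by (simp add: Q_def Y_def algebra_simps)
  moreover have "(real m + 2) * r\<^sup>2 + d * w > 0" using rp w d_pos by (simp add: add_pos_pos)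
  ultimately show ?thesis by auto
qed

lemma radial_derivative:
  assumes x: "x \<in> chart"
  shows "x $ Rad * partial_deriv Rad N x = N x"
proof -
  have rp: "x $ Rad > 0" using x r_pos by (simp add: chart_def)
  define Q where "Q = 2 * (x $ Rad)\<^sup>2 + (m + 1) * d / (x $ Rad) ^ (m + 1)"
  have "Q > 0" using rp d_pos by (simp add: Q_def add_pos_pos)
  moreover have "N x * Q = Q * (x $ Rad * partial_deriv Rad N x)"
    using angular_eq_reduced[OF x] by (simp add: a_zero Q_def)
  ultimately show ?thesis by simp
qed

text \<open>For \<open>a = 0\<close> and \<open>r \<partial>\<^sub>r N = N\<close> the right-hand side of \<open>toral_eq_reduced\<close> is zero, so
  \<open>\<partial>\<^sub>\<theta> N\<close> is constant along a circle on which it has a zero.\<close>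

lemma toral_derivative_zero:
  assumes x: "x \<in> chart"
  shows "partial_deriv (Tor i) N x = 0"
proof -
  let ?e = "axis (Tor i) 1 :: real^('k space_coord)"
  have zero: "partial_deriv (Tor i) (partial_deriv (Tor i) N) y = 0" if y: "y \<in> chart" for y
    using toral_eq_reduced[OF y, of i] radial_derivative[OF y] L_pos by (simp add: a_zero)
  obtain s where s: "partial_deriv (Tor i) N (x + s *\<^sub>R ?e) = 0"
    using toral_critical_point[OF x] by blast
  have "partial_deriv (Tor i) N (x + s *\<^sub>R ?e) = partial_deriv (Tor i) N x"
    by (rule constant_along_line) (use zero x N_differentiable in auto)
  then show ?thesis using s by simp
qed

lemma lapse_linear:
  obtains c where "c > 0" "\<And>x. x \<in> chart \<Longrightarrow> N x = c * x $ Rad"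
proof -
  have rp: "x $ Rad > 0" if "x \<in> chart" for x :: "real^('k space_coord)"
    using that r_pos by (simp add: chart_def)
  let ?F = "\<lambda>x. N x * (1 / x $ Rad)"
  have inv: "((\<lambda>r. 1 / r) has_real_derivative - 1 / (x $ Rad)\<^sup>2) (at (x $ Rad))"
    if "x \<in> chart" for x :: "real^('k space_coord)"
    using rp[OF that] by (auto intro!: derivative_eq_intros simp: power2_eq_square)
  have diff: "?F differentiable (at x)" if x: "x \<in> chart" for x
    by (intro differentiable_mult N_differentiable x differentiable_coordinate[OF inv[OF x]])
  have pd: "partial_deriv p ?F x = 0" if x: "x \<in> chart" for p x
  proof -
    have "partial_deriv p ?F x = partial_deriv p N x * (1 / x $ Rad)
        + N x * (if p = Rad then - 1 / (x $ Rad)\<^sup>2 else 0)"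
      using partial_deriv_mult[OF N_differentiable(1)[OF x] differentiable_coordinate[OF inv[OF x]], of p]
        partial_deriv_coordinate[OF inv[OF x], of p] by simp
    then show ?thesis
      using radial_derivative[OF x] angular_derivative_zero[OF x] toral_derivative_zero[OF x] rp[OF x]
      by (cases p) (auto simp: field_simps power2_eq_square)
  qed
  have "(?F has_derivative (\<lambda>_. 0)) (at x within chart)" if x: "x \<in> chart" for x
  proof -
    have "frechet_derivative ?F (at x) = (\<lambda>_. 0)"
      using frechet_derivative_eq_partial_derivs[OF diff[OF x]] pd[OF x] by (simp add: fun_eq_iff)
    moreover have "(?F has_derivative frechet_derivative ?F (at x)) (at x)"
      using diff[OF x] by (simp add: frechet_derivative_works)
    ultimately show ?thesis by (simp add: has_derivative_at_withinI)
  qed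
  moreover have "convex (chart :: (real^('k space_coord)) set)"
  proof -
    have "chart = {x :: real^('k space_coord). axis Rad 1 \<bullet> x > \<rho>}"
      by (simp add: chart_def inner_axis')
    then show ?thesis by (simp add: convex_halfspace_gt)
  qed
  ultimately obtain c where c: "\<And>x. x \<in> chart \<Longrightarrow> ?F x = c"
    using has_derivative_zero_constant[of chart ?F] by blast
  have eq: "N x = c * x $ Rad" if "x \<in> chart" for x
    using c[OF that] rp[OF that] by (simp add: field_simps)
  have x0: "(\<rho> + 1) *\<^sub>R axis Rad 1 \<in> (chart :: (real^('k space_coord)) set)"
    by (simp add: chart_def)
  have "c > 0" using eq[OF x0] N_positive[OF x0] rho_nonneg
    by (simp add: zero_less_mult_iff)
  with eq show ?thesis by (rule that[rotated])
qed

end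

section \<open>Horowitz--Myers profiles and rescaling of time\<close>

lemma inverse_power_deriv:
  fixes r c :: real
  assumes "r \<noteq> 0"
  shows "((\<lambda>r. c / r ^ k) has_real_derivative - (real k * c / r ^ (k + 1))) (at r)"
proof (cases k)
  case (Suc j)
  have "((\<lambda>r. r ^ Suc j) has_real_derivative real (Suc j) * r ^ j) (at r)"
    using DERIV_pow[of "Suc j" r UNIV] by simp
  note DERIV_divide[OF DERIV_const this, of c]
  moreover have "(0 * r ^ Suc j - c * (real (Suc j) * r ^ j)) / (r ^ Suc j * r ^ Suc j) =
      - (real k * c / r ^ (k + 1))"
    using assms by (simp add: Suc field_simps)
  ultimately show ?thesis using assms by (simp add: Suc mult.commute)
qed simp

lemma soliton_profile_deriv:
  fixes r L a d :: real and m :: nat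
  assumes r: "r > 0" and L: "L > 0"
  shows "((\<lambda>r. r\<^sup>2 / L\<^sup>2 * (1 + a / r ^ (m + 2) - d / r ^ (m + 3))) has_real_derivative
      (2 * r + ((m + 1) * d - m * a * r) / r ^ (m + 2)) / L\<^sup>2) (at r)"
    "((\<lambda>r. (2 * r + ((m + 1) * d - m * a * r) / r ^ (m + 2)) / L\<^sup>2) has_real_derivative
      (2 + (m * (m + 1) * a * r - (m + 1) * (m + 2) * d) / r ^ (m + 3)) / L\<^sup>2) (at r)"
proof -
  have r0: "r \<noteq> 0" using r by simp
  define w where "w = 1 / r ^ m"
  have w: "c / r ^ (m + j) = c * w / r ^ j" for c j by (simp add: w_def power_add)
  have quad: "((\<lambda>r. r\<^sup>2 / L\<^sup>2) has_real_derivative 2 * r / L\<^sup>2) (at r)"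
    by (rule DERIV_cdivide) (auto intro!: derivative_eq_intros)
  have br: "((\<lambda>r. 1 + a / r ^ (m + 2) - d / r ^ (m + 3)) has_real_derivative
      0 + - (real (m + 2) * a / r ^ (m + 2 + 1)) - - (real (m + 3) * d / r ^ (m + 3 + 1))) (at r)"
    by (intro DERIV_diff DERIV_add DERIV_const inverse_power_deriv r0)
  have "2 * r / L\<^sup>2 * (1 + a / r ^ (m + 2) - d / r ^ (m + 3)) + (0 + - (real (m + 2) * a / r ^ (m + 2 + 1))
      - - (real (m + 3) * d / r ^ (m + 3 + 1))) * (r\<^sup>2 / L\<^sup>2) =
      (2 * r + ((m + 1) * d - m * a * r) / r ^ (m + 2)) / L\<^sup>2"
    unfolding w add.assoc using r L by (simp add: field_simps eval_nat_numeral)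
  then show "((\<lambda>r. r\<^sup>2 / L\<^sup>2 * (1 + a / r ^ (m + 2) - d / r ^ (m + 3))) has_real_derivative
      (2 * r + ((m + 1) * d - m * a * r) / r ^ (m + 2)) / L\<^sup>2) (at r)"
    using DERIV_mult[OF quad br] by simp
  have nm: "((\<lambda>r. (m + 1) * d - m * a * r) has_real_derivative - (m * a)) (at r)"
    by (auto intro!: derivative_eq_intros)
  have "((\<lambda>r. (2 * r + ((m + 1) * d - m * a * r) * (1 / r ^ (m + 2))) / L\<^sup>2) has_real_derivative
     (2 + (- (m * a) * (1 / r ^ (m + 2)) + - (real (m + 2) * 1 / r ^ (m + 2 + 1)) * ((m + 1) * d - m * a * r))) / L\<^sup>2) (at r)"
    by (intro DERIV_cdivide DERIV_add DERIV_mult nm inverse_power_deriv r0)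
      (auto intro!: derivative_eq_intros)
  moreover have "(\<lambda>r. (2 * r + ((m + 1) * d - m * a * r) * (1 / r ^ (m + 2))) / L\<^sup>2) =
     (\<lambda>r. (2 * r + ((m + 1) * d - m * a * r) / r ^ (m + 2)) / L\<^sup>2)" by simp
  moreover have "(2 + (- (m * a) * (1 / r ^ (m + 2)) + - (real (m + 2) * 1 / r ^ (m + 2 + 1)) * ((m + 1) * d - m * a * r))) / L\<^sup>2
     = (2 + (m * (m + 1) * a * r - (m + 1) * (m + 2) * d) / r ^ (m + 3)) / L\<^sup>2"
    unfolding w add.assoc using r L by (simp add: field_simps eval_nat_numeral)
  ultimately show "((\<lambda>r. (2 * r + ((m + 1) * d - m * a * r) / r ^ (m + 2)) / L\<^sup>2) has_real_derivative
      (2 + (m * (m + 1) * a * r - (m + 1) * (m + 2) * d) / r ^ (m + 3)) / L\<^sup>2) (at r)"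
    by (simp only:)
qed

lemma jacobian_time_scale:
  fixes x :: "real^('s::finite option)"
  shows "jacobian (time_scale s) (at x) =
    (\<chi> i j. if i = j then (case i of None \<Rightarrow> s | Some _ \<Rightarrow> 1) else 0)"
proof -
  have "linear (time_scale s :: real^('s option) \<Rightarrow> _)"
    by (rule linearI) (auto simp: time_scale_def vec_eq_iff algebra_simps split: option.split)
  then have "(time_scale s has_derivative time_scale s) (at x)"
    by (simp add: linear_conv_bounded_linear bounded_linear_imp_has_derivative)
  then have "frechet_derivative (time_scale s) (at x) = time_scale s"
    by (rule frechet_derivative_at[symmetric])
  then show ?thesis
    by (auto simp: jacobian_def matrix_def time_scale_def vec_eq_iff axis_def split: option.split)
qed

lemma diagonal_congruence:
  fixes A :: "real^'m::finite^'m"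
  defines "J e \<equiv> (\<chi> i j. if i = j then e i else 0)"
  shows "(transpose (J e) ** A ** J e) $ i $ j = e i * A $ i $ j * e j"
proof -
  have J: "J e $ k $ j = (if k = j then e k else 0)" for k j by (simp add: J_def)
  have left: "(transpose (J e) ** A) $ i $ k = e i * A $ i $ k" for k
    by (simp add: matrix_matrix_mult_def transpose_def J if_distrib[of "\<lambda>t. t * _"] cong: if_cong)
  have "(B ** J e) $ i $ j = B $ i $ j * e j" for B :: "real^'m^'m"
    by (simp add: matrix_matrix_mult_def J if_distrib[of "\<lambda>t. _ * t"] cong: if_cong)
  then show ?thesis by (simp add: left)
qed

lemma pullback_time_scale:
  fixes g :: "real^'s::finite \<Rightarrow> real^'s^'s"
  shows "pullback_metric (time_scale s) (static_metric N g) = static_metric (\<lambda>y. s * N y) g"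
proof (intro ext)
  fix x :: "real^('s option)"
  have "space_part (time_scale s x) = space_part x"
    by (simp add: space_part_def time_scale_def vec_eq_iff)
  then have "pullback_metric (time_scale s) (static_metric N g) x $ i $ j =
      static_metric (\<lambda>y. s * N y) g x $ i $ j" for i j
    unfolding pullback_metric_def jacobian_time_scale diagonal_congruence
    by (cases i; cases j) (simp_all add: power2_eq_square)
  then show "pullback_metric (time_scale s) (static_metric N g) x = static_metric (\<lambda>y. s * N y) g x"
    by (simp add: vec_eq_iff)
qed

theorem mainTheorem2:
  fixes n :: nat and L r0 a r_plus \<beta> \<Lambda> :: real
    and V :: "real \<Rightarrow> real"
    and P :: "'k::finite \<Rightarrow> real"
    and N :: "real^('k space_coord) \<Rightarrow> real"
    and g :: "real^('k space_coord) \<Rightarrow> real^('k space_coord)^('k space_coord)"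
    and gt :: "real^('k space_coord option) \<Rightarrow>
                 real^('k space_coord option)^('k space_coord option)"
  assumes n: "n \<ge> 3" "n = CARD('k) + 2"
    and params: "L > 0" "r0 > 0"
    and V: "V = (\<lambda>r. r\<^sup>2 / L\<^sup>2 * (1 + a / r ^ (n - 1) - r0 ^ n / r ^ n))"
    and r_plus: "r_plus > 0" "V r_plus = 0" "\<And>s. s > 0 \<Longrightarrow> V s = 0 \<Longrightarrow> s \<le> r_plus"
    and \<beta>: "\<beta> = 4 * pi * L\<^sup>2 / (r_plus * (real n - 1 + r0 ^ n / r_plus ^ n))"
    and P: "\<And>i. P i > 0"
    and g: "g = spatial_metric V"
    and N_pos: "\<And>x. x $ Rad > r_plus \<Longrightarrow> N x > 0"
    and N_smooth: "smooth_on {x. x $ Rad > r_plus} N"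
    and N_per_phi: "\<And>x. x $ Rad > r_plus \<Longrightarrow> N (x + \<beta> *\<^sub>R axis Ang 1) = N x"
    and N_per_theta: "\<And>x i. x $ Rad > r_plus \<Longrightarrow> N (x + P i *\<^sub>R axis (Tor i) 1) = N x"
    and gt: "gt = static_metric N g"
    and Lam: "\<Lambda> < 0"
    and einstein: "vacuum_einstein_on {x. x $ Some Rad > r_plus} \<Lambda> gt"
  shows "L\<^sup>2 = - (real n * (real n - 1)) / (2 * \<Lambda>) \<and>
    (\<forall>r>0. V r = r\<^sup>2 / L\<^sup>2 * (1 - r0 ^ n / r ^ n)) \<and>
    (\<exists>c>0. (\<forall>x. x $ Rad > r_plus \<longrightarrow> N x = c * x $ Rad) \<and>
       AdS_soliton_on L r0 {x. x $ Some Rad > r_plus}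
         (pullback_metric (time_scale (1 / c)) gt))"
proof -
  define m where "m = CARD('k) - 1"
  have card: "CARD('k) = m + 1" and nm: "n = m + 3"
    using n by (auto simp: m_def)
  define d where "d = r0 ^ n"
  have d: "d > 0" using params by (simp add: d_def)
  have V_def: "V = (\<lambda>r. r\<^sup>2 / L\<^sup>2 * (1 + a / r ^ (m + 2) - d / r ^ (m + 3)))"
    unfolding V d_def nm by simp
  define V' where "V' = (\<lambda>r. (2 * r + ((m + 1) * d - m * a * r) / r ^ (m + 2)) / L\<^sup>2)"
  define V'' where "V'' = (\<lambda>r. (2 + (m * (m + 1) * a * r - (m + 1) * (m + 2) * d) / r ^ (m + 3)) / L\<^sup>2)"
  have pos: "r > 0" if "r > r_plus" for r using that r_plus(1) by simp
  interpret metric_profile V V' V'' r_plus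
  proof
    \<comment> \<open>maximality of the root \<open>r_plus\<close>\<close>
    show "V r \<noteq> 0" if "r > r_plus" for r using r_plus(3)[OF pos[OF that]] that by auto
    show "(V has_real_derivative V' r) (at r)" "(V' has_real_derivative V'' r) (at r)" if "r > r_plus" for r
      using soliton_profile_deriv[OF pos[OF that] params(1)] unfolding V_def V'_def V''_def by blast+
  qed (use r_plus(1) in simp)
  interpret soliton_vacuum V V' V'' r_plus N \<Lambda> "2 * \<Lambda> / (real CARD('k) + 1)" L a d m P
  proof
    show "L\<^sup>2 * V r = r\<^sup>2 + (a * r - d) / r ^ (m + 1)" if "r > r_plus" for r
      using pos[OF that] params(1)
      by (simp add: V_def power_add power2_eq_square power3_eq_cube) (simp add: field_simps)
    show "L\<^sup>2 * (r * V' r) = 2 * r\<^sup>2 + ((m + 1) * d - m * a * r) / r ^ (m + 1)" if "r > r_plus" for r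
      using pos[OF that] params(1)
      by (simp add: V'_def power_add power2_eq_square power3_eq_cube) (simp add: field_simps)
    show "L\<^sup>2 * (r\<^sup>2 * V'' r) = 2 * r\<^sup>2 + (m * (m + 1) * a * r - (m + 1) * (m + 2) * d) / r ^ (m + 1)"
      if "r > r_plus" for r
      using pos[OF that] params(1)
      by (simp add: V''_def power_add power2_eq_square power3_eq_cube) (simp add: field_simps)
  qed (use N_pos N_smooth einstein gt g card params d P N_per_theta in \<open>auto simp: chart_def\<close>)
  have L2: "L\<^sup>2 = - (real n * (real n - 1)) / (2 * \<Lambda>)"
    using mu_eq Lam by (simp add: card nm field_simps)
  have Vr: "V r = r\<^sup>2 / L\<^sup>2 * (1 - r0 ^ n / r ^ n)" for r
    by (simp add: V a_zero)
  have "1 - r0 ^ n / r_plus ^ n = 0"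
    using r_plus(1,2) params by (simp add: Vr)
  then have "r0 ^ n = r_plus ^ n" using r_plus(1) params(2) by simp
  then have r0: "r_plus = r0"
    using power_eq_imp_eq_base[of r0 n r_plus] r_plus(1) params(2) n(1) by simp
  obtain c where c: "c > 0" "\<And>x. x \<in> chart \<Longrightarrow> N x = c * x $ Rad"
    using lapse_linear by blast
  have metric: "pullback_metric (time_scale (1 / c)) gt x = static_metric (\<lambda>y. y $ Rad)
      (spatial_metric (\<lambda>r. r\<^sup>2 / L\<^sup>2 * (1 - r0 ^ (CARD('k) + 2) / r ^ (CARD('k) + 2)))) x"
    if x: "x $ Some Rad > r_plus" for x
  proof -
    have "space_part x \<in> chart" using x by (simp add: chart_def space_part_def)
    then have lapse: "1 / c * N (space_part x) = space_part x $ Rad" using c by simp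
    have "static_metric (\<lambda>y. 1 / c * N y) (spatial_metric V) x =
        static_metric (\<lambda>y. y $ Rad) (spatial_metric V) x"
      unfolding static_metric_def lapse ..
    moreover have "(\<lambda>r. r\<^sup>2 / L\<^sup>2 * (1 - r0 ^ (CARD('k) + 2) / r ^ (CARD('k) + 2))) = V"
      using Vr n(2) by auto
    ultimately show ?thesis
      unfolding gt g pullback_time_scale by (simp only:)
  qed
  have "AdS_soliton_on L r0 {x. x $ Some Rad > r_plus} (pullback_metric (time_scale (1 / c)) gt)"
    unfolding AdS_soliton_on_def using params metric r0 by simp
  then show ?thesis using L2 Vr c by (auto simp: chart_def)
qed

end
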